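(* Let $M$ be a centrally symmetric combinatorial $n$-sphere that is combinatorially $\mathbb{Z}_2$-equivalent to the boundary complex of the $(n+1)$-dimensional cross polytope, and let $\lambda:V(M)\to\{\pm1,\ldots,\pm m\}$ be a labelling of the vertices of $M$ such that $\lambda(-v)=-\lambda(v)$ for every vertex $v\in V(M)$, and $\lambda(u)+\lambda(v)\neq0$ for every edge $\{u,v\}\in M$. Then there are an odd number of positive alternating $n$-simplices of $M$ (with respect to $\lambda$). In particular, $m\geq n+1$.
   Context: All simplicial complexes are finite and are treated as abstract simplicial complexes. Two simplicial complexes are combinatorially equivalent (piecewise linearly homeomorphic) if they have isomorphic subdivisions. A combinatorial $n$-sphere is a simplicial complex combinatorially equivalent to the boundary of an $(n+1)$-simplex. A simplicial $\mathbb{Z}_2$-complex is a simplicial complex $K$ together with a simplicial $\mathbb{Z}_2$-action $\nu:V(K)\to V(K)$ (a simplicial involution); write $-A=\nu(A)$ and $-v=\nu(v)$. The action is always assumed to be free, i.e. $A\cap(-A)=\emptyset$ for every simplex $A\in K$. Two simplicial $\mathbb{Z}_2$-complexes $K,L$ are $\mathbb{Z}_2$-isomorphic if there is a simplicial isomorphism $f:K\to L$ with $f(-A)=-f(A)$ for every face $A\in K$. They are combinatorially $\mathbb{Z}_2$-equivalent if there are a subdivision $K'$ of $K$ and a subdivision $L'$ of $L$, each invariant under the action induced on the polyhedron (and equipped with the induced action), such that $K'$ and $L'$ are $\mathbb{Z}_2$-isomorphic simplicial $\mathbb{Z}_2$-complexes. A centrally symmetric combinatorial $n$-sphere is a combinatorial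 $n$-sphere regarded as a simplicial $\mathbb{Z}_2$-complex via its (free) antipodal action $v\mapsto -v$. The boundary complex of the $(n+1)$-dimensional cross polytope has vertices $\pm e_1,\ldots,\pm e_{n+1}$, its faces are the vertex subsets containing no pair $\{e_i,-e_i\}$, and its action is $v\mapsto -v$. Given a labelling $\lambda:V(K)\to\mathbb{Z}\setminus\{0\}$, an $n$-simplex of $K$ is alternating (with respect to $\lambda$) if its $n+1$ vertices are assigned distinct labels, and the signs of these labels alternate when the labels are ordered by increasing absolute value. An alternating simplex is positive if the label of minimum absolute value is positive. *)

theory Defs
  imports "HOL-Analysis.Analysis" "HOL-Analysis.Finite_Function_Topology"
begin

section \<open>Abstract simplicial complexes and their subdivisions\<close>

(* The empty set counts as a (-1)-dimensional face of every nonvoid complex. *)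
definition abstract_complex :: "'a set set \<Rightarrow> bool" where
  "abstract_complex K \<longleftrightarrow>
     finite K \<and> (\<forall>A\<in>K. finite A) \<and> (\<forall>A\<in>K. \<forall>B. B \<subseteq> A \<longrightarrow> B \<in> K)"

abbreviation vertices :: "'a set set \<Rightarrow> 'a set" where
  "vertices K \<equiv> \<Union>K"

definition n_simplices :: "nat \<Rightarrow> 'a set set \<Rightarrow> 'a set set" where
  "n_simplices n K = {A \<in> K. card A = n + 1}"

definition simplicial_iso :: "('a \<Rightarrow> 'b) \<Rightarrow> 'a set set \<Rightarrow> 'b set set \<Rightarrow> bool" where
  "simplicial_iso f K L \<longleftrightarrow> bij_betw f (vertices K) (vertices L) \<and> (image f) ` K = L"

(* The standard geometric realisation lives in the free real vector space on the
   vertex type: the vertex v is the basis vector at v, and a point is given by its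
   barycentric coordinates. *)
definition vertex_point :: "'a \<Rightarrow> ('a \<Rightarrow>\<^sub>0 real)" where
  "vertex_point v = Poly_Mapping.single v 1"

definition geom_simplex :: "'a set \<Rightarrow> ('a \<Rightarrow>\<^sub>0 real) set" where
  "geom_simplex A = convex hull (vertex_point ` A)"

definition polyhedron_of :: "'a set set \<Rightarrow> ('a \<Rightarrow>\<^sub>0 real) set" where
  "polyhedron_of K = (\<Union>A\<in>K. geom_simplex A)"

(* A subdivision of K is a geometric simplicial complex with the same polyhedron, each of
   whose simplices lies in a simplex of K.  It is recorded as the abstract complex of the
   vertex sets of its simplices, so its vertices are points of the polyhedron. *)
definition subdivision :: "('a \<Rightarrow>\<^sub>0 real) set set \<Rightarrow> 'a set set \<Rightarrow> bool" where
  "subdivision K' K \<longleftrightarrow>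
     abstract_complex K' \<and>
     (\<forall>S\<in>K'. \<not> affine_dependent S) \<and>
     (\<forall>S\<in>K'. \<forall>T\<in>K'. convex hull S \<inter> convex hull T = convex hull (S \<inter> T)) \<and>
     (\<forall>S\<in>K'. \<exists>A\<in>K. convex hull S \<subseteq> geom_simplex A) \<and>
     (\<Union>S\<in>K'. convex hull S) = polyhedron_of K"

definition combinatorially_equivalent :: "'a set set \<Rightarrow> 'b set set \<Rightarrow> bool" where
  "combinatorially_equivalent K L \<longleftrightarrow>
     (\<exists>K' L' f. subdivision K' K \<and> subdivision L' L \<and> simplicial_iso f K' L')"

definition simplex_boundary :: "nat \<Rightarrow> nat set set" where
  "simplex_boundary d = {A. A \<subset> {0..d}}"

definition combinatorial_sphere :: "nat \<Rightarrow> 'a set set \<Rightarrow> bool" where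
  "combinatorial_sphere n K \<longleftrightarrow>
     abstract_complex K \<and> combinatorially_equivalent K (simplex_boundary (n + 1))"


section \<open>Simplicial complexes with a free involution\<close>

definition z2_complex :: "'a set set \<Rightarrow> ('a \<Rightarrow> 'a) \<Rightarrow> bool" where
  "z2_complex K \<nu> \<longleftrightarrow>
     abstract_complex K \<and>
     (\<forall>v\<in>vertices K. \<nu> (\<nu> v) = v) \<and>
     (\<forall>A\<in>K. \<nu> ` A \<in> K) \<and>
     (\<forall>A\<in>K. A \<inter> \<nu> ` A = {})"

definition z2_isomorphic ::
  "'a set set \<Rightarrow> ('a \<Rightarrow> 'a) \<Rightarrow> 'b set set \<Rightarrow> ('b \<Rightarrow> 'b) \<Rightarrow> bool" where
  "z2_isomorphic K \<nu> L \<mu> \<longleftrightarrow>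
     (\<exists>f. simplicial_iso f K L \<and> (\<forall>A\<in>K. f ` (\<nu> ` A) = \<mu> ` (f ` A)))"

(* The linear extension of a vertex map to points in barycentric coordinates. *)
definition induced_map :: "('a \<Rightarrow> 'b) \<Rightarrow> ('a \<Rightarrow>\<^sub>0 real) \<Rightarrow> ('b \<Rightarrow>\<^sub>0 real)" where
  "induced_map f x =
     (\<Sum>v\<in>Poly_Mapping.keys x. Poly_Mapping.single (f v) (Poly_Mapping.lookup x v))"

definition z2_subdivision ::
  "('a \<Rightarrow>\<^sub>0 real) set set \<Rightarrow> 'a set set \<Rightarrow> ('a \<Rightarrow> 'a) \<Rightarrow> bool" where
  "z2_subdivision K' K \<nu> \<longleftrightarrow> subdivision K' K \<and> (\<forall>S\<in>K'. induced_map \<nu> ` S \<in> K')"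

definition combinatorially_z2_equivalent ::
  "'a set set \<Rightarrow> ('a \<Rightarrow> 'a) \<Rightarrow> 'b set set \<Rightarrow> ('b \<Rightarrow> 'b) \<Rightarrow> bool" where
  "combinatorially_z2_equivalent K \<nu> L \<mu> \<longleftrightarrow>
     (\<exists>K' L'. z2_subdivision K' K \<nu> \<and> z2_subdivision L' L \<mu> \<and>
        z2_complex K' (induced_map \<nu>) \<and> z2_complex L' (induced_map \<mu>) \<and>
        z2_isomorphic K' (induced_map \<nu>) L' (induced_map \<mu>))"

definition centrally_symmetric_sphere :: "nat \<Rightarrow> 'a set set \<Rightarrow> ('a \<Rightarrow> 'a) \<Rightarrow> bool" where
  "centrally_symmetric_sphere n M \<nu> \<longleftrightarrow> combinatorial_sphere n M \<and> z2_complex M \<nu>"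

definition unit_vec :: "nat \<Rightarrow> (nat \<Rightarrow>\<^sub>0 real)" where
  "unit_vec i = Poly_Mapping.single i 1"

(* The boundary complex of the d-dimensional cross polytope; its action is uminus. *)
definition cross_polytope_boundary :: "nat \<Rightarrow> (nat \<Rightarrow>\<^sub>0 real) set set" where
  "cross_polytope_boundary d =
     {A. A \<subseteq> (\<Union>i\<in>{1..d}. {unit_vec i, - unit_vec i}) \<and>
         (\<forall>i\<in>{1..d}. \<not> {unit_vec i, - unit_vec i} \<subseteq> A)}"


section \<open>Alternating simplices\<close>

(* The list xs holds the labels of A by increasing absolute value.  The order has to be
   strict: if two labels were opposite, "ordered by absolute value" would be ambiguous. *)
definition alternating :: "('a \<Rightarrow> int) \<Rightarrow> 'a set \<Rightarrow> bool" where
  "alternating l A \<longleftrightarrow> inj_on l A \<and>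
     (\<exists>xs. set xs = l ` A \<and> sorted_wrt (\<lambda>a b. \<bar>a\<bar> < \<bar>b\<bar>) xs \<and>
        (\<forall>i. i + 1 < length xs \<longrightarrow> sgn (xs ! (i + 1)) = - sgn (xs ! i)))"

definition positive_alternating :: "('a \<Rightarrow> int) \<Rightarrow> 'a set \<Rightarrow> bool" where
  "positive_alternating l A \<longleftrightarrow> alternating l A \<and>
     (\<exists>v\<in>A. (\<forall>u\<in>A. \<bar>l v\<bar> \<le> \<bar>l u\<bar>) \<and> l v > 0)"

end

theory Submission
  imports Defs "HOL-Library.Z2"
begin

text \<open>
  Choose a \<open>\<nu>\<close>-equivariant subdivision \<open>M'\<close> of \<open>M\<close> that is isomorphic to an antipodal subdivision
  \<open>L'\<close> of the cross polytope boundary, and label each vertex of \<open>M'\<close> like some vertex of its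
  carrier in \<open>M\<close>, equivariantly.  By Sperner's lemma each face \<open>A\<close> of \<open>M\<close> contains an odd number
  of simplices of \<open>M'\<close> that are mapped onto \<open>A\<close> by the carrier map, so \<open>M\<close> and \<open>M'\<close> have the same
  parity of positive alternating \<open>n\<close>-simplices.  This labelling is transported to \<open>L'\<close>.  In every
  face \<open>A\<close> of the cross polytope, Fan's argument equates the parity of the number of
  alternating top-dimensional simplices with that of the positive alternating ones in the facets
  of \<open>A\<close>; since the antipodal map exchanges positive and negative, summing over all orthants gives
  the result by induction on the dimension.

  Both Sperner's lemma and Fan's argument count modulo 2 the pairs of a simplex and one of its
  facets.  The geometric input is that a simplex \<open>T\<close> of codimension 1 in the subdivision of a
  simplex \<open>A\<close> lies in exactly two top-dimensional ones, or in exactly one if \<open>T\<close> lies in the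
  boundary of \<open>A\<close>.  Passing to cones over simplices makes this a statement of linear algebra.
\<close>

section \<open>Codimension-one simplices of a subdivided simplicial cone\<close>

text \<open>A vector of \<open>span D\<close> outside \<open>span T\<close> could be adjoined to
  \<open>T\<close>, giving an independent set with more elements than \<open>D\<close> inside
  \<open>span D\<close>. Used to see that top-dimensional simplices span everything.\<close>

lemma span_eq_of_card_eq:
  fixes T :: "'v::real_vector set"
  assumes "finite D" "independent T" "T \<subseteq> span D" "card T = card D"
  shows "span T = span D"
proof
  show "span T \<subseteq> span D"
    using assms(3) span_minimal subspace_span by blast
  have "x \<in> span T" if x: "x \<in> span D" for x
  proof (rule ccontr)
    assume nx: "x \<notin> span T"
    then have "independent (insert x T)" "x \<notin> T"
      using assms(2) independent_insertI span_base by blast+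
    moreover have "finite T"
      using independent_span_bound[OF assms(1,2,3)] by blast
    ultimately show False
      using independent_span_bound[OF assms(1), of "insert x T"] x assms(3,4) by auto
  qed
  then show "span D \<subseteq> span T" by blast
qed

lemma span_scaleR_iff:
  fixes x :: "'v::real_vector"
  assumes "c \<noteq> 0"
  shows "c *\<^sub>R x \<in> span S \<longleftrightarrow> x \<in> span S"
  using span_scale[of "c *\<^sub>R x" S "inverse c"] span_scale[of x S c] assms by auto

text \<open>The closed cone generated by an independent \<open>S\<close>. Since
  \<open>representation S x\<close> vanishes outside \<open>S\<close>, the condition for all
  \<open>s\<close> only concerns the generators.\<close>

definition conic_span :: "'v::real_vector set \<Rightarrow> 'v set" where
  "conic_span S = {x \<in> span S. \<forall>s. 0 \<le> representation S x s}"

text \<open>\<open>\<Sum>T\<close> has all its \<open>T\<close>-coordinates equal to 1, which makes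
  it a convenient relative interior point of the cone over \<open>T\<close>.\<close>

lemma representation_sum_set:
  fixes T :: "'v::real_vector set"
  assumes "finite T" "T \<subseteq> S" "independent S"
  shows "representation S (\<Sum>T) x = (if x \<in> T then 1 else 0)"
proof -
  have "representation S (\<Sum>T) x = (\<Sum>i\<in>T. representation S i x)"
    using representation_sum[OF assms(3), of T "\<lambda>i. i"] assms(2) span_superset[of S] by (simp add: subset_iff)
  also have "\<dots> = (\<Sum>i\<in>T. if x = i then 1 else 0)"
    using assms by (intro sum.cong) (auto simp: representation_basis)
  finally show ?thesis using assms(1) by simp
qed

lemma representation_add_scale:
  fixes x y :: "'v::real_vector"
  assumes "independent S" "x \<in> span S" "y \<in> span S"
  shows "representation S (x + c *\<^sub>R y) b = representation S x b + c * representation S y b"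
  using assms by (simp add: representation_add representation_scale span_scale)

text \<open>The coordinates of \<open>\<Sum>T\<close> at \<open>T\<close> are 1 and survive a small
  perturbation; the one at a new \<open>u\<close> starts at 0 and cannot decrease, by the sign
  assumption on \<open>w\<close>.\<close>

lemma near_barycenter_in_conic_span:
  fixes T :: "'v::real_vector set"
  assumes "finite T" "independent (insert u T)" "w \<in> span (insert u T)"
    and "0 \<le> representation (insert u T) w u"
  shows "\<exists>\<delta>>0. \<forall>e. 0 < e \<and> e < \<delta> \<longrightarrow> \<Sum>T + e *\<^sub>R w \<in> conic_span (insert u T)"
proof -
  let ?r = "representation (insert u T) w"
  \<comment> \<open>\<open>B\<close> dominates every coordinate of \<open>w\<close> at
    \<open>T\<close>, so \<open>e < 1 / B\<close> changes these coordinates by less than 1. The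
    summand 1 keeps \<open>B\<close> positive when \<open>T\<close> is empty.\<close>
  define B where "B = 1 + (\<Sum>x\<in>T. \<bar>?r x\<bar>)"
  have B: "B > 0" unfolding B_def by (intro add_pos_nonneg sum_nonneg) auto
  have sT: "\<Sum>T \<in> span (insert u T)"
    by (meson span_base span_sum subset_insertI subsetD)
  have "\<Sum>T + e *\<^sub>R w \<in> conic_span (insert u T)" if e: "0 < e" "e < 1 / B" for e
  proof -
    have "0 \<le> (if s \<in> T then 1 else 0) + e * ?r s" for s
    proof (cases "s \<in> T")
      case True
      have "\<bar>?r s\<bar> \<le> (\<Sum>x\<in>T. \<bar>?r x\<bar>)"
        using True assms(1) by (intro member_le_sum) auto
      then have "\<bar>?r s\<bar> \<le> B" by (simp add: B_def)
      then have "e * \<bar>?r s\<bar> \<le> e * B" using e by (intro mult_left_mono) auto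
      also have "\<dots> < 1" using e B by (simp add: field_simps)
      finally have "e * \<bar>?r s\<bar> \<le> 1" by simp
      moreover have "\<bar>e * ?r s\<bar> = e * \<bar>?r s\<bar>" using e by (simp add: abs_mult)
      ultimately show ?thesis using True by simp
    next
      case False
      then show ?thesis
        using assms(4) e representation_ne_zero[of "insert u T" w s] by (cases "s = u") force+
    qed
    then have "\<forall>s. 0 \<le> representation (insert u T) (\<Sum>T + e *\<^sub>R w) s"
      using representation_add_scale[OF assms(2) sT assms(3)]
        representation_sum_set[OF assms(1) subset_insertI assms(2)] by simp
    then show ?thesis
      using assms(3) sT unfolding conic_span_def by (simp add: span_add span_scale)
  qed
  then show ?thesis using B by (intro exI[of _ "1/B"]) auto
qed

text \<open>The cone version of a triangulated simplex: \<open>D\<close> generates the big cone, and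
  \<open>F\<close> holds generator sets of the cones of all dimensions that subdivide it.\<close>

locale conic_subdivision =
  fixes D :: "'v::real_vector set" and F :: "'v set set"
  assumes finite_D: "finite D" and indep_D: "independent D"
    and finite_F: "finite F"
    and finite_mem: "S \<in> F \<Longrightarrow> finite S"
    and indep_mem: "S \<in> F \<Longrightarrow> independent S"
    and mem_subset: "S \<in> F \<Longrightarrow> S \<subseteq> conic_span D"
    and inter: "S \<in> F \<Longrightarrow> T \<in> F \<Longrightarrow> conic_span S \<inter> conic_span T \<subseteq> conic_span (S \<inter> T)"
    and cover: "conic_span D \<subseteq> (\<Union>S\<in>F. conic_span S)"
begin

lemma mem_span: "S \<in> F \<Longrightarrow> S \<subseteq> span D"
  using mem_subset by (auto simp: conic_span_def)

lemma card_le: "S \<in> F \<Longrightarrow> card S \<le> card D"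
  using independent_span_bound[OF finite_D indep_mem mem_span] by blast

text \<open>The \<open>D\<close>-coordinates of a conic combination are nonnegative combinations of
  the nonnegative \<open>D\<close>-coordinates of its generators.\<close>

lemma conic_span_mem_subset:
  assumes "S \<in> F" shows "conic_span S \<subseteq> conic_span D"
proof
  fix x assume x: "x \<in> conic_span S"
  have eq: "(\<Sum>s\<in>S. representation S x s *\<^sub>R s) = x"
    using x indep_mem[OF assms] finite_mem[OF assms] by (intro real_vector.sum_representation_eq) (auto simp: conic_span_def)
  have sp: "x \<in> span D"
    using x mem_span[OF assms] span_minimal[OF _ subspace_span] by (auto simp: conic_span_def)
  have "representation D x d = (\<Sum>s\<in>S. representation S x s * representation D s d)" for d
    using mem_span[OF assms] indep_D
    by (subst (1) eq[symmetric])
      (subst representation_sum; auto simp: representation_scale span_scale subset_iff)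
  then show "x \<in> conic_span D"
    using sp x mem_subset[OF assms] by (auto simp: conic_span_def intro!: sum_nonneg mult_nonneg_nonneg)
qed

text \<open>The simplices of \<open>F\<close> adjacent to \<open>T\<close> are found by moving from the barycentre of \<open>T\<close>, scaled to
  \<open>\<Sum>T\<close>, in a direction \<open>w\<close> transversal to \<open>T\<close>: at most one of them lies on that side, and one does iff
  the move stays in the cone over \<open>D\<close>.\<close>

lemma side_neighbours:
  assumes T: "T \<in> F" "Suc (card T) = card D" and w: "w \<in> span D" "w \<notin> span T"
  shows "card {u. u \<notin> T \<and> insert u T \<in> F \<and> 0 < representation (insert u T) w u} =
    (if \<exists>\<delta>>0. \<forall>e. 0 < e \<and> e < \<delta> \<longrightarrow> \<Sum>T + e *\<^sub>R w \<in> conic_span D then 1 else 0)"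
    (is "card ?N = (if ?G then 1 else 0)")
proof -
  have fT: "finite T" and iT: "independent T" using T finite_mem indep_mem by auto
  have sT: "\<Sum>T \<in> span T" by (meson span_base span_sum)
  have notin: "\<Sum>T + e *\<^sub>R w \<notin> span T" if "e \<noteq> 0" for e
    using that w(2) sT by (simp add: span_add_eq span_scaleR_iff)
  have spans: "span (insert u T) = span D" if "u \<notin> T" "insert u T \<in> F" for u
    using that T fT by (intro span_eq_of_card_eq finite_D indep_mem mem_span) auto
  have small: "\<exists>\<delta>>0. \<forall>e. 0 < e \<and> e < \<delta> \<longrightarrow> \<Sum>T + e *\<^sub>R w \<in> conic_span (insert u T)" if "u \<in> ?N" for u
    using that w spans[of u] indep_mem[of "insert u T"]
    by (intro near_barycenter_in_conic_span fT) auto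
  \<comment> \<open>Two neighbours on the same side would share the points
    \<open>\<Sum>T + e *\<^sub>R w\<close> for small \<open>e\<close>. By \<open>inter\<close> these
    lie in the cone over \<open>T\<close>, although \<open>w\<close> leaves
    \<open>span T\<close>.\<close>
  have uniq: "u = v" if u: "u \<in> ?N" and v: "v \<in> ?N" for u v
  proof (rule ccontr)
    assume "u \<noteq> v"
    then have i: "insert u T \<inter> insert v T = T" using u v by auto
    obtain d1 d2 where d: "d1 > 0" "d2 > 0"
      "\<And>e. 0 < e \<and> e < d1 \<Longrightarrow> \<Sum>T + e *\<^sub>R w \<in> conic_span (insert u T)"
      "\<And>e. 0 < e \<and> e < d2 \<Longrightarrow> \<Sum>T + e *\<^sub>R w \<in> conic_span (insert v T)"
      using small[OF u] small[OF v] by metis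
    define e where "e = min d1 d2 / 2"
    have e: "0 < e" "e < d1" "e < d2" using d(1,2) by (auto simp: e_def)
    then have "\<Sum>T + e *\<^sub>R w \<in> conic_span T"
      using inter[of "insert u T" "insert v T"] d(3,4)[of e] u v i by auto
    then show False using notin[of e] e by (auto simp: conic_span_def)
  qed
  have G: "?G" if "u \<in> ?N" for u
    using small[OF that] conic_span_mem_subset[of "insert u T"] that by blast
  have ex: "?N \<noteq> {}" if G: "?G"
  proof -
    obtain \<delta> where \<delta>: "\<delta> > 0" "\<And>e. 0 < e \<and> e < \<delta> \<Longrightarrow> \<Sum>T + e *\<^sub>R w \<in> conic_span D"
      using G by auto
    \<comment> \<open>A sequence of points tending to \<open>\<Sum>T\<close> along \<open>w\<close>.
      Starting the denominators at 2 keeps every step strictly below \<open>\<delta>\<close>; by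
      pigeonhole, one of the finitely many cones contains infinitely many of the points.\<close>
    define P where "P j S \<longleftrightarrow> \<Sum>T + (\<delta> / (real j + 2)) *\<^sub>R w \<in> conic_span S" for j S
    have small_j: "0 < \<delta> / (real j + 2)" "\<delta> / (real j + 2) < \<delta>" for j
      using \<delta>(1) by (simp_all add: field_simps) (smt (verit) mult_nonneg_nonneg of_nat_0_le_iff)
    have "\<forall>j. \<exists>S\<in>F. P j S"
      using \<delta>(2) small_j cover unfolding P_def by blast
    then obtain g where g: "\<And>j. g j \<in> F" "\<And>j. P j (g j)" by metis
    have "finite (range g)" using g(1) finite_F by (meson finite_subset image_subsetI)
    then obtain j0 where j0: "infinite {j. g j = g j0}"
      using pigeonhole_infinite[of "UNIV :: nat set" g] by auto
    define S where "S = g j0"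
    have S: "S \<in> F" using g(1) by (simp add: S_def)
    have "P j S" if "g j = g j0" for j
      using g(2)[of j] that by (simp add: S_def)
    then have "{j. g j = g j0} \<subseteq> {j. P j S}" by blast
    then have inf: "infinite {j. P j S}" using j0 finite_subset by blast
    have fS: "finite S" and iS: "independent S" using S finite_mem indep_mem by auto
    \<comment> \<open>So the chosen cone contains points of the ray arbitrarily close to
      \<open>\<Sum>T\<close>.\<close>
    have arb: "\<exists>e>0. e < r \<and> \<Sum>T + e *\<^sub>R w \<in> conic_span S" if r: "r > 0" for r :: real
    proof -
      obtain k where k: "\<delta> / r < real k" using reals_Archimedean2 by blast
      obtain j where j: "j \<ge> k" "P j S" using inf unfolding infinite_nat_iff_unbounded_le by auto
      have "\<delta> / r < real j + 2" using k j(1) by linarith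
      then have "\<delta> / (real j + 2) < r" using r \<delta>(1) by (simp add: field_simps)
      then show ?thesis using j(2) small_j unfolding P_def by blast
    qed
    \<comment> \<open>The difference of two ray points in the cone is a nonzero multiple of
      \<open>w\<close>; hence both \<open>w\<close> and \<open>\<Sum>T\<close> lie in
      \<open>span S\<close>.\<close>
    obtain e1 where e1: "e1 > 0" "\<Sum>T + e1 *\<^sub>R w \<in> conic_span S" using arb[of 1] by auto
    obtain e2 where e2: "e2 > 0" "e2 < e1" "\<Sum>T + e2 *\<^sub>R w \<in> conic_span S" using arb[of e1] e1 by auto
    have "(e1 - e2) *\<^sub>R w \<in> span S"
      using span_diff[of "\<Sum>T + e1 *\<^sub>R w" S "\<Sum>T + e2 *\<^sub>R w"] e1 e2
      by (auto simp: conic_span_def scaleR_diff_left)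
    then have wS: "w \<in> span S" using e2(2) by (simp add: span_scaleR_iff)
    have "(\<Sum>T + e1 *\<^sub>R w) - e1 *\<^sub>R w \<in> span S"
      using e1 wS by (intro span_diff span_scale) (auto simp: conic_span_def)
    then have pS: "\<Sum>T \<in> span S" by simp
    \<comment> \<open>Closedness of the cone: a negative coordinate \<open>?a\<close> at
      \<open>\<Sum>T\<close> would remain negative for every step shorter than
      \<open>- ?a / (1 + \<bar>?b\<bar>)\<close>.\<close>
    have "0 \<le> representation S (\<Sum>T) s" for s
    proof (rule ccontr)
      let ?a = "representation S (\<Sum>T) s" and ?b = "representation S w s"
      assume neg: "\<not> 0 \<le> ?a"
      obtain e where e: "0 < e" "e < - ?a / (1 + \<bar>?b\<bar>)" "\<Sum>T + e *\<^sub>R w \<in> conic_span S"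
        using arb[of "- ?a / (1 + \<bar>?b\<bar>)"] neg by (auto simp: divide_neg_pos)
      have "0 \<le> ?a + e * ?b"
        using e(3) representation_add_scale[OF iS pS wS] by (auto simp: conic_span_def)
      moreover have "e * (1 + \<bar>?b\<bar>) < - ?a" using e(2) by (simp add: field_simps)
      moreover have "e * ?b \<le> e * (1 + \<bar>?b\<bar>)" using e(1) by (intro mult_left_mono) auto
      ultimately show False by linarith
    qed
    then have "\<Sum>T \<in> conic_span S" using pS by (simp add: conic_span_def)
    moreover have "\<Sum>T \<in> conic_span T"
      using sT representation_sum_set[OF fT order_refl iT] by (simp add: conic_span_def)
    ultimately have TS: "\<Sum>T \<in> conic_span (T \<inter> S)" using inter[OF T(1) S] by blast
    \<comment> \<open>\<open>\<Sum>T\<close> lies in the cone over \<open>T \<inter> S\<close>, but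
      by uniqueness of coordinates all its \<open>T\<close>-coordinates are 1, so no element of
      \<open>T\<close> can be missing from \<open>S\<close>.\<close>
    have "T \<subseteq> S"
    proof
      fix t assume t: "t \<in> T"
      have "representation T (\<Sum>T) = representation (T \<inter> S) (\<Sum>T)"
        using TS by (intro representation_extend iT) (auto simp: conic_span_def)
      then have "representation (T \<inter> S) (\<Sum>T) t \<noteq> 0"
        using representation_sum_set[OF fT order_refl iT] t by simp
      then show "t \<in> S" using representation_ne_zero by blast
    qed
    \<comment> \<open>\<open>w\<close> separates \<open>S\<close> from \<open>T\<close>, and the
      bound \<open>card D\<close> leaves room for exactly one further generator
      \<open>u\<close>.\<close>
    moreover have "S \<noteq> T" using wS w by auto
    ultimately have "card S = Suc (card T)"
      using card_le[OF S] T(2) psubset_card_mono[OF fS, of T] by (simp add: psubset_eq)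
    then have "card (S - T) = 1" using \<open>T \<subseteq> S\<close> fT by (simp add: card_Diff_subset)
    then obtain u where "S - T = {u}" by (auto simp: card_1_singleton_iff)
    then have u: "S = insert u T" "u \<notin> T" using \<open>T \<subseteq> S\<close> by auto
    let ?r = "representation S w u"
    \<comment> \<open>The \<open>u\<close>-coordinate of \<open>\<Sum>T\<close> is 0, so that of the
      ray point is \<open>e1\<close> times that of \<open>w\<close>. It cannot vanish, as
      \<open>w\<close> would then lie in \<open>span T\<close>.\<close>
    have "0 \<le> representation S (\<Sum>T + e1 *\<^sub>R w) u"
      using e1(2) by (simp add: conic_span_def)
    then have "0 \<le> e1 * ?r"
      using representation_add_scale[OF iS pS wS, of e1 u]
        representation_sum_set[OF fT \<open>T \<subseteq> S\<close> iS, of u] u(2) by simp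
    then have "0 \<le> ?r" using e1(1) by (simp add: zero_le_mult_iff)
    moreover have "?r \<noteq> 0"
    proof
      assume r0: "?r = 0"
      have "w = (\<Sum>x\<in>S. representation S w x *\<^sub>R x)"
        using fS iS wS by (simp add: real_vector.sum_representation_eq)
      also have "\<dots> = (\<Sum>x\<in>T. representation S w x *\<^sub>R x)"
        using u fT r0 by simp
      also have "\<dots> \<in> span T" by (intro span_sum span_scale span_base)
      finally show False using w by simp
    qed
    ultimately have "u \<in> ?N" using S u by auto
    then show ?thesis by blast
  qed
  show ?thesis
  proof (cases "?G")
    case True
    then obtain u where u: "u \<in> ?N" using ex by blast
    then have "?N = {u}" using uniq by blast
    then show ?thesis using True by simp
  next
    case False
    then have "?N = {}" using G by blast
    then show ?thesis using False by (metis card.empty)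
  qed
qed

text \<open>Fix \<open>d0\<close> in \<open>D\<close> outside \<open>span T\<close>. Every neighbour
  of \<open>T\<close> lies on the side of \<open>d0\<close> or of \<open>- d0\<close>, according to
  the sign of the \<open>u\<close>-coordinate of \<open>d0\<close>. Moving towards \<open>d0\<close>
  never leaves the cone, which gives one neighbour; moving towards \<open>- d0\<close> leaves it at
  once exactly when \<open>T\<close> lies in the facet opposite \<open>d0\<close>, and then that
  facet supplies the missing 1.\<close>

theorem facet_degree:
  assumes T: "T \<in> F" "Suc (card T) = card D"
  shows "card {S \<in> F. card S = card D \<and> T \<subset> S} + card {d \<in> D. T \<subseteq> span (D - {d})} = 2"
proof -
  have fT: "finite T" and iT: "independent T" using T finite_mem indep_mem by auto
  have "\<not> D \<subseteq> span T"
    using independent_span_bound[OF fT indep_D] T(2) by auto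
  then obtain d0 where d0: "d0 \<in> D" "d0 \<notin> span T" by blast
  then have d0s: "d0 \<in> span D" "- d0 \<in> span D" "- d0 \<notin> span T"
    using span_neg[of "- d0" T] by (auto simp: span_base span_neg)
  let ?A = "{u. u \<notin> T \<and> insert u T \<in> F}"
  let ?r = "\<lambda>w u. representation (insert u T) w u"
  let ?P = "{u. u \<notin> T \<and> insert u T \<in> F \<and> 0 < ?r d0 u}"
  let ?M = "{u. u \<notin> T \<and> insert u T \<in> F \<and> 0 < ?r (- d0) u}"
  have spans: "span (insert u T) = span D" if "u \<in> ?A" for u
    using that T fT by (intro span_eq_of_card_eq finite_D indep_mem mem_span) auto
  have neg: "?r (- d0) u = - ?r d0 u" if "u \<in> ?A" for u
    using spans[OF that] that d0s indep_mem by (subst representation_neg) auto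
  have nz: "?r d0 u \<noteq> 0" if "u \<in> ?A" for u
  proof
    assume "?r d0 u = 0"
    moreover have "(\<Sum>x\<in>insert u T. representation (insert u T) d0 x *\<^sub>R x) = d0"
      using spans[OF that] that d0s(1) fT indep_mem by (intro sum_representation_eq) auto
    ultimately have "d0 = (\<Sum>x\<in>T. representation (insert u T) d0 x *\<^sub>R x)"
      using that fT by simp
    also have "\<dots> \<in> span T" by (intro span_sum span_scale span_base)
    finally show False using d0 by simp
  qed
  have "?A \<subseteq> \<Union>F" by blast
  then have finA: "finite ?A" using finite_F finite_mem by (meson finite_Union finite_subset)
  have "u \<in> ?P \<or> u \<in> ?M" "\<not> (u \<in> ?P \<and> u \<in> ?M)" if "u \<in> ?A" for u
    using neg[OF that] nz[OF that] that by (cases "0 < ?r d0 u"; simp)+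
  then have A: "?A = ?P \<union> ?M" "?P \<inter> ?M = {}" by blast+
  have "{S \<in> F. card S = card D \<and> T \<subset> S} = (\<lambda>u. insert u T) ` ?A"
  proof (intro subset_antisym subsetI)
    fix S assume S: "S \<in> {S \<in> F. card S = card D \<and> T \<subset> S}"
    then have "card (S - T) = 1" using T(2) fT by (simp add: card_Diff_subset psubset_eq)
    then obtain u where "S - T = {u}" by (auto simp: card_1_singleton_iff)
    then have "S = insert u T" "u \<notin> T" using S by auto
    then show "S \<in> (\<lambda>u. insert u T) ` ?A" using S by auto
  qed (use T(2) fT in auto)
  moreover have "inj_on (\<lambda>u. insert u T) ?A" by (auto simp: inj_on_def)
  ultimately have "card {S \<in> F. card S = card D \<and> T \<subset> S} = card ?A"
    by (simp add: card_image)
  also have "\<dots> = card ?P + card ?M"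
    using finA A by (metis (no_types, lifting) card_Un_disjoint finite_Un)
  finally have split: "card {S \<in> F. card S = card D \<and> T \<subset> S} = card ?P + card ?M" .
  let ?p = "\<Sum>T"
  have psp: "?p \<in> span D" using mem_span[OF T(1)] by (meson span_sum subsetD)
  have rep_p: "representation D ?p d = (\<Sum>t\<in>T. representation D t d)" for d
    using representation_sum[OF indep_D, of T "\<lambda>t. t"] mem_span[OF T(1)] by (simp add: subset_iff)
  have tnn: "0 \<le> representation D t d" if "t \<in> T" for t d
    using mem_subset[OF T(1)] that by (auto simp: conic_span_def)
  have pnn: "0 \<le> representation D ?p d" for d
    unfolding rep_p by (intro sum_nonneg tnn)
  have add: "representation D (?p + e *\<^sub>R d0) d = representation D ?p d + (if d = d0 then e else 0)" for e d
    using representation_add_scale[OF indep_D psp d0s(1)] representation_basis[OF indep_D d0(1)] by simp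
  have spD: "?p + e *\<^sub>R d0 \<in> span D" for e using psp d0s by (intro span_add span_scale)
  have "card ?P = 1"
  proof -
    have "\<exists>\<delta>>0. \<forall>e. 0 < e \<and> e < \<delta> \<longrightarrow> ?p + e *\<^sub>R d0 \<in> conic_span D"
      using add pnn spD by (intro exI[of _ 1]) (auto simp: conic_span_def)
    then show ?thesis using side_neighbours[OF T d0s(1) d0(2)] by simp
  qed
  \<comment> \<open>The \<open>d\<close>-coordinates of the elements of \<open>T\<close> are
    nonnegative, so their sum vanishes only if each of them does.\<close>
  have zero: "T \<subseteq> span (D - {d}) \<longleftrightarrow> representation D ?p d = 0" if "d \<in> D" for d
  proof
    assume sub: "T \<subseteq> span (D - {d})"
    have "representation D t d = 0" if "t \<in> T" for t
    proof -
      have "representation D t = representation (D - {d}) t"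
        using sub that by (intro representation_extend[OF indep_D]) auto
      then show ?thesis using representation_ne_zero[of "D - {d}" t d] by auto
    qed
    then show "representation D ?p d = 0" by (simp add: rep_p)
  next
    assume z: "representation D ?p d = 0"
    show "T \<subseteq> span (D - {d})"
    proof
      fix t assume t: "t \<in> T"
      have "representation D t d = 0"
        using z t tnn fT by (simp add: rep_p sum_nonneg_eq_0_iff)
      moreover have "(\<Sum>x\<in>D. representation D t x *\<^sub>R x) = t"
        using mem_span[OF T(1)] t finite_D by (intro sum_representation_eq indep_D) auto
      ultimately have "t = (\<Sum>x\<in>D - {d}. representation D t x *\<^sub>R x)"
        using finite_D \<open>d \<in> D\<close> by (simp add: sum.remove)
      also have "\<dots> \<in> span (D - {d})" by (intro span_sum span_scale span_base)
      finally show "t \<in> span (D - {d})" .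
    qed
  qed
  \<comment> \<open>Inside the facet opposite \<open>d\<close>, the set \<open>T\<close> has full
    dimension and spans it. For \<open>d \<noteq> d0\<close> this span contains \<open>d0\<close>,
    against the choice of \<open>d0\<close>.\<close>
  have only: "d = d0" if "d \<in> D" "T \<subseteq> span (D - {d})" for d
  proof (rule ccontr)
    assume "d \<noteq> d0"
    have "span T = span (D - {d})"
      using that finite_D iT T(2) by (intro span_eq_of_card_eq) auto
    then show False using d0 \<open>d \<noteq> d0\<close> by (auto simp: span_base)
  qed
  have Z: "{d \<in> D. T \<subseteq> span (D - {d})} = (if representation D ?p d0 = 0 then {d0} else {})"
  proof (cases "representation D ?p d0 = 0")
    case True
    then show ?thesis using zero[OF d0(1)] d0(1) by (auto dest: only)
  next
    case False
    then have "\<not> T \<subseteq> span (D - {d0})" using zero[OF d0(1)] by simp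
    then show ?thesis using only False by (metis (no_types, lifting) empty_Collect_eq)
  qed
  have "card ?M = (if representation D ?p d0 = 0 then 0 else 1)"
  proof -
    let ?x = "representation D ?p d0"
    \<comment> \<open>Only the \<open>d0\<close>-coordinate changes along \<open>- d0\<close>, so it
      alone decides how far the move stays in the cone.\<close>
    have mem: "?p + e *\<^sub>R (- d0) \<in> conic_span D \<longleftrightarrow> e \<le> ?x" for e
      using add[of "- e"] spD[of "- e"] pnn by (auto simp: conic_span_def split: if_splits)
    have "(\<exists>\<delta>>0. \<forall>e. 0 < e \<and> e < \<delta> \<longrightarrow> ?p + e *\<^sub>R (- d0) \<in> conic_span D) \<longleftrightarrow> ?x \<noteq> 0"
      unfolding mem
    proof
      assume "\<exists>\<delta>>0. \<forall>e. 0 < e \<and> e < \<delta> \<longrightarrow> e \<le> ?x"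
      then obtain \<delta> where "\<delta> > 0" and h: "\<And>e. 0 < e \<Longrightarrow> e < \<delta> \<Longrightarrow> e \<le> ?x" by auto
      then have "\<delta> / 2 \<le> ?x" using h[of "\<delta> / 2"] by simp
      then show "?x \<noteq> 0" using \<open>\<delta> > 0\<close> by linarith
    next
      assume "?x \<noteq> 0"
      then show "\<exists>\<delta>>0. \<forall>e. 0 < e \<and> e < \<delta> \<longrightarrow> e \<le> ?x"
        using pnn[of d0] by (intro exI[of _ ?x]) auto
    qed
    then show ?thesis using side_neighbours[OF T d0s(2,3)] by simp
  qed
  then show ?thesis by (simp add: split Z \<open>card ?P = 1\<close>)
qed

end

section \<open>Alternating label sets\<close>

text \<open>These rules would turn sums in \<open>bit\<close> into cardinalities and bit operations.\<close>

declare sum_of_bool_eq [simp del] sum_mult_of_bool_eq [simp del]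
  add_bit_eq_xor [simp del] mult_bit_eq_and [simp del]

text \<open>The empty set counts as alternating, so that inductions can start with the empty face.\<close>

definition signed_alternating :: "int \<Rightarrow> int set \<Rightarrow> bool" where
  "signed_alternating s X \<longleftrightarrow>
     inj_on abs X \<and> (\<forall>x\<in>X. sgn x = s * (-1) ^ card {y \<in> X. \<bar>y\<bar> < \<bar>x\<bar>})"

text \<open>Signs are prescribed through the rank in absolute value rather than through a sorted
  list; \<open>s\<close> is the sign at rank 0.\<close>

definition alternating_from :: "int \<Rightarrow> ('a \<Rightarrow> int) \<Rightarrow> 'a set \<Rightarrow> bool" where
  "alternating_from s l A \<longleftrightarrow> inj_on l A \<and> signed_alternating s (l ` A)"

text \<open>An element of largest absolute value leaves the other ranks unchanged and itself has
  rank \<open>card X\<close>.\<close>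

lemma signed_alternating_insert_max:
  assumes "\<And>y. y \<in> X \<Longrightarrow> \<bar>y\<bar> < \<bar>v\<bar>"
  shows "signed_alternating s (insert v X) \<longleftrightarrow>
    signed_alternating s X \<and> sgn v = s * (-1) ^ card X"
proof -
  have "{y \<in> insert v X. \<bar>y\<bar> < \<bar>v\<bar>} = X" using assms by auto
  moreover have "{y \<in> insert v X. \<bar>y\<bar> < \<bar>x\<bar>} = {y \<in> X. \<bar>y\<bar> < \<bar>x\<bar>}" if "x \<in> X" for x
    using assms[OF that] by auto
  moreover have "\<bar>v\<bar> \<notin> abs ` X" "v \<notin> X" using assms by fastforce+
  ultimately show ?thesis
    unfolding signed_alternating_def by (auto simp: inj_on_insert)
qed

text \<open>The combinatorial core of Fan's argument. A positive alternating set stays so only after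
  removal of its last element, a negative one becomes positive only by losing its first element, and
  any other set has an even number of good removals. The induction adds elements by increasing
  absolute value.\<close>

lemma sum_signed_alternating_remove:
  assumes "finite X" "inj_on abs X" "0 \<notin> X" "X \<noteq> {}"
  shows "(\<Sum>x\<in>X. of_bool (signed_alternating 1 (X - {x}))) =
    (of_bool (signed_alternating 1 X) + of_bool (signed_alternating (-1) X) :: bit)"
  using assms
proof (induction X rule: finite_ranking_induct[where f = "abs :: int \<Rightarrow> int"])
  case empty
  then show ?case by simp
next
  case (insert v S)
  show ?case
  proof (cases "v \<in> S")
    case True
    then show ?thesis using insert by (simp add: insert_absorb)
  next
    case False
    have lt: "\<bar>y\<bar> < \<bar>v\<bar>" if "y \<in> S" for y
      using insert.hyps(2)[OF that] insert.prems(1) that False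
      by (metis inj_on_insert Diff_empty Diff_insert0 image_eqI order_le_less)
    have ins: "signed_alternating s (insert v S) \<longleftrightarrow>
        signed_alternating s S \<and> sgn v = s * (-1) ^ card S" for s
      using lt by (rule signed_alternating_insert_max)
    have sgn: "sgn v = 1 \<or> sgn v = -1" using insert.prems(2) by (auto simp: sgn_if)
    have "(\<Sum>x\<in>insert v S. of_bool (signed_alternating 1 (insert v S - {x})) :: bit) =
      of_bool (signed_alternating 1 S) +
      (\<Sum>x\<in>S. of_bool (signed_alternating 1 (insert v S - {x})))"
      using False insert.hyps(1) by simp
    \<comment> \<open>Removing an element below \<open>v\<close> lowers the rank of \<open>v\<close>
      by one and so reverses the sign required of \<open>v\<close>.\<close>
    also have "(\<Sum>x\<in>S. of_bool (signed_alternating 1 (insert v S - {x})) :: bit) =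
      (\<Sum>x\<in>S. of_bool (signed_alternating 1 (S - {x})) * of_bool (sgn v = - ((-1) ^ card S)))"
    proof (rule sum.cong[OF refl])
      fix x assume x: "x \<in> S"
      have "insert v S - {x} = insert v (S - {x})" using x False by auto
      moreover have "(-1 :: int) ^ card (S - {x}) = - ((-1) ^ card S)"
        using card_Suc_Diff1[OF insert.hyps(1) x] by (metis minus_minus mult_minus1 power_Suc)
      moreover have "signed_alternating 1 (insert v (S - {x})) \<longleftrightarrow>
          signed_alternating 1 (S - {x}) \<and> sgn v = 1 * (-1) ^ card (S - {x})"
        using lt by (intro signed_alternating_insert_max) blast
      ultimately show "(of_bool (signed_alternating 1 (insert v S - {x})) :: bit) =
          of_bool (signed_alternating 1 (S - {x})) * of_bool (sgn v = - ((-1) ^ card S))"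
        by (simp only: of_bool_conj mult_1)
    qed
    also have "\<dots> = (\<Sum>x\<in>S. of_bool (signed_alternating 1 (S - {x}))) * of_bool (sgn v = - ((-1) ^ card S))"
      by (rule sum_distrib_right[symmetric])
    finally have eq: "(\<Sum>x\<in>insert v S. of_bool (signed_alternating 1 (insert v S - {x})) :: bit) =
      of_bool (signed_alternating 1 S) +
      (\<Sum>x\<in>S. of_bool (signed_alternating 1 (S - {x}))) * of_bool (sgn v = - ((-1) ^ card S))" .
    define c where "c = (-1 :: int) ^ card S"
    have pm: "c = 1 \<or> c = -1" by (cases "even (card S)") (auto simp: c_def)
    show ?thesis
    proof (cases "S = {}")
      case True
      then show ?thesis unfolding eq ins using sgn by (auto simp: signed_alternating_def)
    next
      case False
      have IH: "(\<Sum>x\<in>S. of_bool (signed_alternating 1 (S - {x})) :: bit) =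
        of_bool (signed_alternating 1 S) + of_bool (signed_alternating (-1) S)"
        using insert False by (intro insert.IH) auto
      \<comment> \<open>If \<open>sgn v = c\<close>, both sides say whether \<open>S\<close> is
        positive alternating. If \<open>sgn v = - c\<close>, this term occurs twice on the left and
        cancels, leaving the negative one.\<close>
      show ?thesis
        unfolding eq IH ins unfolding c_def[symmetric] using sgn pm
        by (elim disjE) (simp_all add: add.commute)
    qed
  qed
qed

text \<open>If \<open>g u = g v\<close>, only the removal of \<open>u\<close> or of \<open>v\<close>
  can make \<open>g\<close> injective, and these two removals have the same image, so they cancel
  modulo 2.\<close>

lemma sum_remove_not_inj:
  fixes g :: "'a \<Rightarrow> 'b"
  assumes "finite S" "\<not> inj_on g S"
  shows "(\<Sum>x\<in>S. of_bool (inj_on g (S - {x}) \<and> Q (g ` (S - {x})))) = (0::bit)"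
proof -
  obtain u v where uv: "u \<in> S" "v \<in> S" "u \<noteq> v" "g u = g v"
    using assms(2) by (auto simp: inj_on_def)
  define R where "R = S - {u, v}"
  define h where "h x = (of_bool (inj_on g (S - {x}) \<and> Q (g ` (S - {x}))) :: bit)" for x
  have S: "S = insert u (insert v R)" and uvR: "u \<notin> R" "v \<notin> R" using uv by (auto simp: R_def)
  have "h x = 0" if "x \<in> R" for x
    using that uv by (auto simp: h_def R_def inj_on_def)
  then have "sum h S = h u + h v"
    using assms(1) uvR uv(3) unfolding S by simp
  also have "S - {u} = insert v R" "S - {v} = insert u R" using S uvR uv(3) by auto
  then have "h u = h v" using uv(4) uvR by (simp add: h_def inj_on_insert)
  finally show ?thesis by (simp add: h_def)
qed

text \<open>Injective labels reduce to the count on the label set, the others cancel. The hypothesis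
  excludes the label 0 (case \<open>u = v\<close>) and distinct labels of equal absolute
  value.\<close>

lemma sum_alternating_from_remove:
  assumes "finite A" "A \<noteq> {}" "\<And>u v. u \<in> A \<Longrightarrow> v \<in> A \<Longrightarrow> l u + l v \<noteq> 0"
  shows "(\<Sum>x\<in>A. of_bool (alternating_from 1 l (A - {x}))) =
    (of_bool (alternating_from 1 l A) + of_bool (alternating_from (-1) l A) :: bit)"
proof (cases "inj_on l A")
  case True
  have abs: "inj_on abs (l ` A)"
  proof (rule inj_onI, clarify)
    fix u v assume "u \<in> A" "v \<in> A" "\<bar>l u\<bar> = \<bar>l v\<bar>"
    then show "l u = l v" using assms(3)[of u v] by linarith
  qed
  have "0 \<notin> l ` A"
  proof
    assume "0 \<in> l ` A"
    then obtain u where "u \<in> A" "l u = 0" by (metis imageE)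
    then show False using assms(3)[of u u] by simp
  qed
  have img: "l ` (A - {x}) = l ` A - {l x}" "inj_on l (A - {x})" if "x \<in> A" for x
    using True that by (auto simp: inj_on_def)
  have "(\<Sum>x\<in>A. of_bool (alternating_from 1 l (A - {x})) :: bit) =
      (\<Sum>y\<in>l ` A. of_bool (signed_alternating 1 (l ` A - {y})))"
    using True by (simp add: sum.reindex alternating_from_def img)
  also have "\<dots> = of_bool (signed_alternating 1 (l ` A)) + of_bool (signed_alternating (-1) (l ` A))"
    using assms abs \<open>0 \<notin> l ` A\<close> by (intro sum_signed_alternating_remove) auto
  finally show ?thesis using True by (simp add: alternating_from_def)
next
  case False
  then show ?thesis
    using sum_remove_not_inj[OF assms(1) False, of "signed_alternating 1"]
    by (simp add: alternating_from_def)
qed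

text \<open>Negation preserves the ranks and reverses every sign.\<close>

lemma alternating_from_uminus:
  "alternating_from s (\<lambda>x. - l x) A \<longleftrightarrow> alternating_from (- s) l A"
proof -
  have im: "(\<lambda>x. - l x) ` A = uminus ` l ` A" by auto
  have card: "card {y \<in> uminus ` X. \<bar>y\<bar> < \<bar>x\<bar>} = card {y \<in> X. \<bar>y\<bar> < \<bar>x\<bar>}" for X :: "int set" and x
  proof -
    have "{y \<in> uminus ` X. \<bar>y\<bar> < \<bar>x\<bar>} = uminus ` {y \<in> X. \<bar>y\<bar> < \<bar>x\<bar>}" by auto
    then show ?thesis by (simp add: card_image)
  qed
  have sgn: "sgn (- x) = s * c \<longleftrightarrow> sgn x = - s * c" for x c :: int
  proof -
    have "- a = b \<longleftrightarrow> a = - b" for a b :: int by presburger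
    moreover have "sgn (- x) = - sgn x" by (simp add: sgn_if)
    ultimately show ?thesis by (simp only: mult_minus_left)
  qed
  have inj: "inj_on abs (uminus ` X) \<longleftrightarrow> inj_on abs X" for X :: "int set"
    by (simp add: inj_on_def)
  have "signed_alternating s (uminus ` X) \<longleftrightarrow> signed_alternating (- s) X" for X
    unfolding signed_alternating_def inj by (simp only: ball_simps(9) abs_minus_cancel card sgn)
  moreover have "inj_on (\<lambda>x. - l x) A = inj_on l A" by (simp add: inj_on_def)
  ultimately show ?thesis unfolding alternating_from_def im by simp
qed

lemma alternating_from_cong:
  assumes "\<And>x. x \<in> A \<Longrightarrow> l x = l' x"
  shows "alternating_from s l A = alternating_from s l' A"
  unfolding alternating_from_def using inj_on_cong[of A l l'] image_cong[of A A l l'] assms by simp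

lemma alternating_from_image:
  assumes "inj_on f A"
  shows "alternating_from s l (f ` A) = alternating_from s (l \<circ> f) A"
  using assms unfolding alternating_from_def by (simp add: image_comp comp_inj_on_iff)

section \<open>Comparison with the definition of alternating simplices by sorted lists\<close>

lemma card_smaller_sorted:
  assumes "sorted_wrt (\<lambda>a b. \<bar>a\<bar> < \<bar>b\<bar>) xs" "i < length (xs :: int list)"
  shows "card {y \<in> set xs. \<bar>y\<bar> < \<bar>xs ! i\<bar>} = i"
proof -
  have lt: "\<bar>xs ! j\<bar> < \<bar>xs ! k\<bar>" if "j < k" "k < length xs" for j k
    using assms(1) that by (simp add: sorted_wrt_iff_nth_less)
  have "{y \<in> set xs. \<bar>y\<bar> < \<bar>xs ! i\<bar>} = (!) xs ` {..<i}"
  proof (intro subset_antisym subsetI)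
    fix y assume "y \<in> {y \<in> set xs. \<bar>y\<bar> < \<bar>xs ! i\<bar>}"
    then obtain j where j: "j < length xs" "y = xs ! j" "\<bar>xs ! j\<bar> < \<bar>xs ! i\<bar>"
      by (auto simp: in_set_conv_nth)
    then have "j < i" using lt[of i j] by (cases i j rule: linorder_cases) auto
    then show "y \<in> (!) xs ` {..<i}" using j by auto
  qed (use lt assms(2) in auto)
  moreover have "inj_on ((!) xs) {..<i}"
    using lt assms(2) by (intro linorder_inj_onI) (fastforce+)
  ultimately show ?thesis by (simp add: card_image)
qed

lemma signed_alternating_sorted:
  assumes "sorted_wrt (\<lambda>a b. \<bar>a\<bar> < \<bar>b\<bar>) xs"
  shows "signed_alternating s (set xs) \<longleftrightarrow> (\<forall>i<length xs. sgn (xs ! i) = s * (-1) ^ i)"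
proof -
  have "inj_on abs (set xs)"
    using assms by (induction xs) auto
  then show ?thesis
    unfolding signed_alternating_def
    using card_smaller_sorted[OF assms] by (auto simp: all_set_conv_all_nth)
qed

lemma sorted_abs_list_exists:
  assumes "finite X" "inj_on abs X"
  shows "\<exists>xs. set xs = X \<and> sorted_wrt (\<lambda>a b. \<bar>a\<bar> < \<bar>b :: int\<bar>) xs"
  using assms
proof (induction X rule: finite_ranking_induct[where f = "abs :: int \<Rightarrow> int"])
  case (insert v S)
  show ?case
  proof (cases "v \<in> S")
    case False
    have lt: "\<bar>y\<bar> < \<bar>v\<bar>" if "y \<in> S" for y
      using insert.hyps(2)[OF that] insert.prems(1) that False
      by (metis inj_on_insert Diff_empty Diff_insert0 image_eqI order_le_less)
    obtain xs where "set xs = S" "sorted_wrt (\<lambda>a b. \<bar>a\<bar> < \<bar>b\<bar>) xs"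
      using insert by auto
    then show ?thesis using lt by (intro exI[of _ "xs @ [v]"]) (auto simp: sorted_wrt_append)
  qed (use insert in \<open>simp add: insert_absorb\<close>)
qed simp

text \<open>The vertex of minimal absolute label sits at index 0 of the sorted list, and the
  alternation propagates its sign along the indices, which are the ranks. The empty set satisfies
  only the right-hand side and is excluded.\<close>

lemma positive_alternating_iff:
  assumes "finite A" "A \<noteq> {}" "\<And>v. v \<in> A \<Longrightarrow> l v \<noteq> 0"
  shows "positive_alternating l A \<longleftrightarrow> alternating_from 1 l A"
proof
  assume "positive_alternating l A"
  then obtain xs v where inj: "inj_on l A" and xs: "set xs = l ` A" "sorted_wrt (\<lambda>a b. \<bar>a\<bar> < \<bar>b\<bar>) xs"
    "\<And>i. i + 1 < length xs \<Longrightarrow> sgn (xs ! (i + 1)) = - sgn (xs ! i)"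
    and v: "v \<in> A" "\<And>u. u \<in> A \<Longrightarrow> \<bar>l v\<bar> \<le> \<bar>l u\<bar>" "l v > 0"
    unfolding positive_alternating_def alternating_def by blast
  obtain j where j: "j < length xs" "l v = xs ! j"
    using v(1) xs(1) by (metis image_eqI in_set_conv_nth)
  have "j = 0"
  proof (rule ccontr)
    assume "j \<noteq> 0"
    then have "\<bar>xs ! 0\<bar> < \<bar>l v\<bar>" using xs(2) j by (simp add: sorted_wrt_iff_nth_less)
    moreover have "xs ! 0 \<in> l ` A" using xs(1) j(1) by (metis gr_zeroI nth_mem not_less_zero)
    ultimately show False using v(2) by fastforce
  qed
  then have "sgn (xs ! i) = (-1) ^ i" if "i < length xs" for i
    using that by (induction i) (use v(3) j xs(3) in auto)
  then show "alternating_from 1 l A"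
    using inj signed_alternating_sorted[OF xs(2), of 1] xs(1) by (simp add: alternating_from_def)
next
  assume alt: "alternating_from 1 l A"
  then obtain xs where xs: "set xs = l ` A" "sorted_wrt (\<lambda>a b. \<bar>a\<bar> < \<bar>b\<bar>) xs"
    using sorted_abs_list_exists[of "l ` A"] assms(1)
    by (auto simp: alternating_from_def signed_alternating_def)
  have sgn: "sgn (xs ! i) = (-1) ^ i" if "i < length xs" for i
    using that alt signed_alternating_sorted[OF xs(2), of 1] xs(1) by (simp add: alternating_from_def)
  have len: "0 < length xs" using xs(1) assms(2) by auto
  then obtain v where v: "v \<in> A" "l v = xs ! 0" using xs(1) nth_mem by (metis imageE)
  have "\<bar>l v\<bar> \<le> \<bar>l u\<bar>" if u: "u \<in> A" for u
  proof -
    obtain i where "i < length xs" "l u = xs ! i"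
      using u xs(1) by (metis image_eqI in_set_conv_nth)
    then show ?thesis
      using xs(2) v(2) by (cases i) (auto simp: sorted_wrt_iff_nth_less less_imp_le)
  qed
  moreover have "l v > 0" using sgn[OF len] v(2) by (simp add: sgn_if split: if_splits)
  ultimately show "positive_alternating l A"
    unfolding positive_alternating_def alternating_def
    using alt xs sgn v(1) by (auto simp: alternating_from_def intro!: exI[of _ xs] bexI[of _ v])
qed

section \<open>Barycentric coordinates\<close>

lemma lookup_scaleR [simp]:
  "Poly_Mapping.lookup (c *\<^sub>R x) i = c *\<^sub>R Poly_Mapping.lookup x i"
proof -
  have "finite {i. c *\<^sub>R Poly_Mapping.lookup x i \<noteq> 0}"
    by (rule finite_subset[OF _ finite_lookup[of x]]) auto
  then show ?thesis by (simp add: scaleR_poly_mapping_def)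
qed

lemma lookup_vertex_point: "Poly_Mapping.lookup (vertex_point v) u = (if u = v then 1 else 0)"
  by (simp add: vertex_point_def lookup_single when_def)

lemma inj_vertex_point: "inj vertex_point"
  by (intro injI) (metis lookup_vertex_point zero_neq_one)

lemma lookup_combination:
  assumes "finite A"
  shows "Poly_Mapping.lookup (\<Sum>v\<in>A. c v *\<^sub>R vertex_point v) u = (if u \<in> A then c u else 0)"
  using assms by (simp add: lookup_sum lookup_vertex_point if_distrib cong: if_cong)

lemma combination_lookup:
  assumes "finite A" "Poly_Mapping.keys x \<subseteq> A"
  shows "(\<Sum>v\<in>A. Poly_Mapping.lookup x v *\<^sub>R vertex_point v) = x"
  by (rule poly_mapping_eqI) (use assms in \<open>auto simp: lookup_combination in_keys_iff\<close>)

lemma independent_vertex_points: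
  assumes "finite A"
  shows "independent (vertex_point ` A)"
proof -
  have "u x = 0" if u: "(\<Sum>x\<in>vertex_point ` A. u x *\<^sub>R x) = 0" "x \<in> vertex_point ` A" for u x
  proof -
    obtain v where v: "v \<in> A" "x = vertex_point v" using u(2) by auto
    have "(\<Sum>v\<in>A. u (vertex_point v) *\<^sub>R vertex_point v) = 0"
      using u(1) by (simp add: sum.reindex inj_on_subset[OF inj_vertex_point])
    then show ?thesis
      using lookup_combination[OF assms, of "\<lambda>v. u (vertex_point v)" v] v by simp
  qed
  then show ?thesis using assms by (subst dependent_finite) auto
qed

text \<open>Writing the coordinate as a sum over \<open>A\<close> also covers those \<open>y\<close>
  that are not vertex points, where it is 0.\<close>

lemma representation_vertex_points:
  assumes "finite A" "Poly_Mapping.keys x \<subseteq> A"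
  shows "x \<in> span (vertex_point ` A)"
    and "representation (vertex_point ` A) x y = (\<Sum>v\<in>A. if y = vertex_point v then Poly_Mapping.lookup x v else 0)"
proof -
  have mem: "vertex_point v \<in> span (vertex_point ` A)" if "v \<in> A" for v
    using that by (simp add: span_base)
  show "x \<in> span (vertex_point ` A)"
    by (subst combination_lookup[OF assms, symmetric]) (intro span_sum span_scale mem)
  show "representation (vertex_point ` A) x y = (\<Sum>v\<in>A. if y = vertex_point v then Poly_Mapping.lookup x v else 0)"
    by (subst combination_lookup[OF assms, symmetric], subst representation_sum)
      (auto intro!: sum.cong independent_vertex_points assms mem span_scale
        simp: representation_scale representation_basis independent_vertex_points assms mem)
qed

lemma span_vertex_points:
  assumes "finite A"
  shows "span (vertex_point ` A) = {x. Poly_Mapping.keys x \<subseteq> A}"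
proof -
  have "Poly_Mapping.keys x \<subseteq> A" if x: "x \<in> span (vertex_point ` A)" for x
  proof -
    define r where "r v = representation (vertex_point ` A) x (vertex_point v)" for v
    have "x = (\<Sum>y\<in>vertex_point ` A. representation (vertex_point ` A) x y *\<^sub>R y)"
      using x assms by (intro sum_representation_eq[symmetric] independent_vertex_points) auto
    also have "\<dots> = (\<Sum>v\<in>A. r v *\<^sub>R vertex_point v)"
      by (simp add: sum.reindex inj_on_subset[OF inj_vertex_point] r_def)
    finally have "Poly_Mapping.lookup x u = (if u \<in> A then r u else 0)" for u
      using lookup_combination[OF assms, of r u] by simp
    then show ?thesis by (auto simp: in_keys_iff split: if_splits)
  qed
  then show ?thesis using representation_vertex_points(1)[OF assms] by blast
qed

lemma conic_span_vertex_points: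
  assumes "finite A"
  shows "conic_span (vertex_point ` A) =
    {x. Poly_Mapping.keys x \<subseteq> A \<and> (\<forall>v. 0 \<le> Poly_Mapping.lookup x v)}"
proof -
  have "(\<forall>y. 0 \<le> representation (vertex_point ` A) x y) \<longleftrightarrow> (\<forall>v. 0 \<le> Poly_Mapping.lookup x v)"
    if x: "Poly_Mapping.keys x \<subseteq> A" for x
  proof
    assume nn: "\<forall>y. 0 \<le> representation (vertex_point ` A) x y"
    show "\<forall>v. 0 \<le> Poly_Mapping.lookup x v"
    proof
      fix v
      show "0 \<le> Poly_Mapping.lookup x v"
      proof (cases "v \<in> A")
        case True
        have "(\<Sum>u\<in>A. if vertex_point v = vertex_point u then Poly_Mapping.lookup x u else 0) =
            (\<Sum>u\<in>A. if v = u then Poly_Mapping.lookup x u else 0)"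
          by (intro sum.cong) (auto dest: injD[OF inj_vertex_point])
        then show ?thesis
          using nn[rule_format, of "vertex_point v"] representation_vertex_points(2)[OF assms x] True assms
          by simp
      next
        case False
        then have "Poly_Mapping.lookup x v = 0" using x in_keys_iff[of v x] by blast
        then show ?thesis by simp
      qed
    qed
  qed (auto simp: representation_vertex_points[OF assms x] intro!: sum_nonneg)
  then show ?thesis
    unfolding conic_span_def span_vertex_points[OF assms] by auto
qed

lemma conic_span_iff:
  assumes "finite S" "independent S"
  shows "x \<in> conic_span S \<longleftrightarrow> (\<exists>c. (\<forall>s\<in>S. 0 \<le> c s) \<and> x = (\<Sum>s\<in>S. c s *\<^sub>R s))"
proof
  assume "x \<in> conic_span S"
  then show "\<exists>c. (\<forall>s\<in>S. 0 \<le> c s) \<and> x = (\<Sum>s\<in>S. c s *\<^sub>R s)"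
    using sum_representation_eq[OF assms(2) _ assms(1), of x]
    by (intro exI[of _ "representation S x"]) (auto simp: conic_span_def)
next
  assume "\<exists>c. (\<forall>s\<in>S. 0 \<le> c s) \<and> x = (\<Sum>s\<in>S. c s *\<^sub>R s)"
  then obtain c where c: "\<And>s. s \<in> S \<Longrightarrow> 0 \<le> c s" "x = (\<Sum>s\<in>S. c s *\<^sub>R s)" by auto
  have "representation S x y = (\<Sum>s\<in>S. c s * (if y = s then 1 else 0))" for y
    unfolding c(2)
    by (subst representation_sum[OF assms(2)])
      (auto simp: representation_scale[OF assms(2)] representation_basis[OF assms(2)] span_base span_scale
        intro!: sum.cong)
  then have "0 \<le> representation S x y" for y
    using c(1) by (simp add: sum_nonneg)
  moreover have "x \<in> span S"
    unfolding c(2) by (intro span_sum span_scale span_base)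
  ultimately show "x \<in> conic_span S" by (simp add: conic_span_def)
qed

lemma conic_span_scale:
  assumes "x \<in> conic_span S" "independent S" "0 \<le> c"
  shows "c *\<^sub>R x \<in> conic_span S"
  using assms by (auto simp: conic_span_def representation_scale span_scale)

text \<open>A linear height function with value 1 on the polyhedron; normalising it to 1 leads from
  a cone back to the simplex.\<close>

definition coord_sum :: "('a \<Rightarrow>\<^sub>0 real) \<Rightarrow> real" where
  "coord_sum x = (\<Sum>v\<in>Poly_Mapping.keys x. Poly_Mapping.lookup x v)"

lemma coord_sum_eq:
  assumes "finite A" "Poly_Mapping.keys x \<subseteq> A"
  shows "coord_sum x = (\<Sum>v\<in>A. Poly_Mapping.lookup x v)"
  unfolding coord_sum_def using assms by (intro sum.mono_neutral_left) (auto simp: in_keys_iff)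

text \<open>Coordinates may cancel in the combination, so everything is summed over the union of the
  supports before the two sums are exchanged.\<close>

lemma coord_sum_combination:
  assumes "finite S"
  shows "coord_sum (\<Sum>s\<in>S. c s *\<^sub>R s) = (\<Sum>s\<in>S. c s * coord_sum s)"
proof -
  let ?A = "\<Union>s\<in>S. Poly_Mapping.keys s"
  have fin: "finite ?A" using assms by simp
  have look: "Poly_Mapping.lookup (\<Sum>s\<in>S. c s *\<^sub>R s) v = (\<Sum>s\<in>S. c s * Poly_Mapping.lookup s v)" for v
    by (simp add: lookup_sum)
  have "Poly_Mapping.keys (\<Sum>s\<in>S. c s *\<^sub>R s) \<subseteq> ?A"
  proof
    fix v assume "v \<in> Poly_Mapping.keys (\<Sum>s\<in>S. c s *\<^sub>R s)"
    then have "(\<Sum>s\<in>S. c s * Poly_Mapping.lookup s v) \<noteq> 0" by (simp add: in_keys_iff look)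
    then obtain s where "s \<in> S" "c s * Poly_Mapping.lookup s v \<noteq> 0" by (meson sum.neutral)
    then show "v \<in> ?A" by (auto simp: in_keys_iff)
  qed
  then have "coord_sum (\<Sum>s\<in>S. c s *\<^sub>R s) = (\<Sum>v\<in>?A. \<Sum>s\<in>S. c s * Poly_Mapping.lookup s v)"
    using coord_sum_eq[OF fin] look by simp
  also have "\<dots> = (\<Sum>s\<in>S. c s * (\<Sum>v\<in>?A. Poly_Mapping.lookup s v))"
    by (subst sum.swap) (simp add: sum_distrib_left)
  also have "\<dots> = (\<Sum>s\<in>S. c s * coord_sum s)"
    by (intro sum.cong refl, subst coord_sum_eq[OF fin]) auto
  finally show ?thesis .
qed

lemma coord_sum_scale: "coord_sum (c *\<^sub>R x) = c * coord_sum x"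
  using coord_sum_combination[of "{x}" "\<lambda>_. c"] by simp

lemma coord_sum_pos:
  assumes "\<And>v. 0 \<le> Poly_Mapping.lookup x v" "x \<noteq> 0"
  shows "0 < coord_sum x"
proof -
  obtain v where "v \<in> Poly_Mapping.keys x" using assms(2) keys_eq_empty by blast
  then show ?thesis unfolding coord_sum_def
    using assms(1) by (intro sum_pos2[of _ v]) (auto simp: in_keys_iff order_less_le)
qed

lemma geom_simplex_iff:
  assumes "finite A"
  shows "x \<in> geom_simplex A \<longleftrightarrow>
    Poly_Mapping.keys x \<subseteq> A \<and> (\<forall>v. 0 \<le> Poly_Mapping.lookup x v) \<and> coord_sum x = 1"
proof
  assume "x \<in> geom_simplex A"
  then obtain w where w: "\<forall>y\<in>vertex_point ` A. 0 \<le> w y" "sum w (vertex_point ` A) = 1"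
    "(\<Sum>y\<in>vertex_point ` A. w y *\<^sub>R y) = x"
    unfolding geom_simplex_def convex_hull_finite[OF finite_imageI[OF assms]] by blast
  define u where "u v = w (vertex_point v)" for v
  have u: "\<And>v. v \<in> A \<Longrightarrow> 0 \<le> u v" "(\<Sum>v\<in>A. u v) = 1" "x = (\<Sum>v\<in>A. u v *\<^sub>R vertex_point v)"
    using w by (simp_all add: u_def sum.reindex inj_on_subset[OF inj_vertex_point] o_def)
  have look: "Poly_Mapping.lookup x v = (if v \<in> A then u v else 0)" for v
    using lookup_combination[OF assms, of u v] u(3) by simp
  then have keys: "Poly_Mapping.keys x \<subseteq> A" by (auto simp: in_keys_iff split: if_splits)
  then show "Poly_Mapping.keys x \<subseteq> A \<and> (\<forall>v. 0 \<le> Poly_Mapping.lookup x v) \<and> coord_sum x = 1"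
    using u look coord_sum_eq[OF assms keys] by simp
next
  assume x: "Poly_Mapping.keys x \<subseteq> A \<and> (\<forall>v. 0 \<le> Poly_Mapping.lookup x v) \<and> coord_sum x = 1"
  then have x': "Poly_Mapping.keys x \<subseteq> A" "\<And>v. 0 \<le> Poly_Mapping.lookup x v" "coord_sum x = 1" by auto
  \<comment> \<open>Convex weights are indexed by points, hence the inverse of
    \<open>vertex_point\<close>.\<close>
  define u where "u y = Poly_Mapping.lookup x (the_inv vertex_point y)" for y :: "'a \<Rightarrow>\<^sub>0 real"
  have "u (vertex_point v) = Poly_Mapping.lookup x v" for v
    by (simp add: u_def the_inv_f_f[OF inj_vertex_point])
  then have "(\<forall>y\<in>vertex_point ` A. 0 \<le> u y) \<and> sum u (vertex_point ` A) = 1 \<and>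
      (\<Sum>y\<in>vertex_point ` A. u y *\<^sub>R y) = x"
    using x'(2,3) combination_lookup[OF assms x'(1)] coord_sum_eq[OF assms x'(1)]
    by (simp add: sum.reindex inj_on_subset[OF inj_vertex_point] o_def)
  then show "x \<in> geom_simplex A"
    unfolding geom_simplex_def convex_hull_finite[OF finite_imageI[OF assms]] by blast
qed

section \<open>Subdivisions of a single face\<close>

lemma of_nat_bit: "(of_nat n :: bit) = of_bool (odd n)"
  by (induction n) auto

text \<open>A complex with empty polyhedron also has the void subdivision. Nonemptiness puts the
  empty simplex into \<open>K'\<close>, where inductions over faces start.\<close>

locale subdivided_complex =
  fixes K' :: "('a \<Rightarrow>\<^sub>0 real) set set" and K :: "'a set set"
  assumes complex: "abstract_complex K" and subdiv: "subdivision K' K" and nonempty: "K' \<noteq> {}"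
begin

text \<open>The simplices of \<open>K'\<close> inside the face \<open>A\<close>. Supports suffice to
  express this, because vertices of \<open>K'\<close> have nonnegative coordinates with sum
  1.\<close>

definition subdiv_of :: "'a set \<Rightarrow> ('a \<Rightarrow>\<^sub>0 real) set set" where
  "subdiv_of A = {S \<in> K'. \<forall>x\<in>S. Poly_Mapping.keys x \<subseteq> A}"

definition top_simplices :: "'a set \<Rightarrow> ('a \<Rightarrow>\<^sub>0 real) set set" where
  "top_simplices A = {S \<in> subdiv_of A. card S = card A}"

lemma finite_face: "A \<in> K \<Longrightarrow> finite A"
  using complex unfolding abstract_complex_def by blast

lemma face_subset: "A \<in> K \<Longrightarrow> B \<subseteq> A \<Longrightarrow> B \<in> K"
  using complex unfolding abstract_complex_def by blast

lemma finite_K': "finite K'" and finite_simplex: "S \<in> K' \<Longrightarrow> finite S"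
  and simplex_subset: "S \<in> K' \<Longrightarrow> T \<subseteq> S \<Longrightarrow> T \<in> K'"
proof -
  have "abstract_complex K'" using subdiv unfolding subdivision_def by (elim conjE)
  then show "finite K'" "S \<in> K' \<Longrightarrow> finite S" "S \<in> K' \<Longrightarrow> T \<subseteq> S \<Longrightarrow> T \<in> K'"
    unfolding abstract_complex_def by blast+
qed

lemma inter_hull: "S \<in> K' \<Longrightarrow> T \<in> K' \<Longrightarrow> convex hull S \<inter> convex hull T = convex hull (S \<inter> T)"
  and covered: "(\<Union>S\<in>K'. convex hull S) = polyhedron_of K"
proof -
  have "\<forall>S\<in>K'. \<forall>T\<in>K'. convex hull S \<inter> convex hull T = convex hull (S \<inter> T)"
    using subdiv unfolding subdivision_def by (elim conjE)
  then show "S \<in> K' \<Longrightarrow> T \<in> K' \<Longrightarrow> convex hull S \<inter> convex hull T = convex hull (S \<inter> T)"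
    by blast
  show "(\<Union>S\<in>K'. convex hull S) = polyhedron_of K"
    using subdiv unfolding subdivision_def by (elim conjE)
qed

lemma empty_mem: "{} \<in> K'"
  using nonempty simplex_subset by blast

lemma finite_subdiv_of: "finite (subdiv_of A)" and finite_top_simplices: "finite (top_simplices A)"
  using finite_K' by (simp_all add: subdiv_of_def top_simplices_def)

lemma carrier:
  assumes "S \<in> K'"
  obtains A where "A \<in> K" "\<And>x. x \<in> S \<Longrightarrow> x \<in> geom_simplex A"
proof -
  have "\<forall>S\<in>K'. \<exists>A\<in>K. convex hull S \<subseteq> geom_simplex A"
    using subdiv unfolding subdivision_def by (elim conjE)
  then have "\<exists>A\<in>K. convex hull S \<subseteq> geom_simplex A" using assms by (rule bspec)
  then show thesis using that hull_subset[of S convex] by blast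
qed

lemma vertex_coords:
  assumes "x \<in> S" "S \<in> K'"
  shows "0 \<le> Poly_Mapping.lookup x v" "coord_sum x = 1"
proof -
  obtain A where "A \<in> K" "x \<in> geom_simplex A" using carrier[OF assms(2)] assms(1) by blast
  then show "0 \<le> Poly_Mapping.lookup x v" "coord_sum x = 1"
    using geom_simplex_iff[OF finite_face] by blast+
qed

text \<open>All vertices have height 1, so the coefficients of a linear relation sum to 0 and the
  relation is an affine one.\<close>

lemma independent_simplex:
  assumes S: "S \<in> K'"
  shows "independent S"
proof
  assume "dependent S"
  then obtain u where u: "\<exists>v\<in>S. u v \<noteq> 0" "(\<Sum>v\<in>S. u v *\<^sub>R v) = 0"
    using dependent_finite[OF finite_simplex[OF S]] by auto
  have "(\<Sum>s\<in>S. u s * coord_sum s) = 0"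
    using coord_sum_combination[OF finite_simplex[OF S], of u] u(2) by (simp add: coord_sum_def)
  then have "sum u S = 0" using vertex_coords(2)[OF _ S] by simp
  then have "affine_dependent S"
    using u affine_dependent_explicit_finite[OF finite_simplex[OF S]] by blast
  moreover have "\<forall>S\<in>K'. \<not> affine_dependent S"
    using subdiv unfolding subdivision_def by (elim conjE)
  ultimately show False using S by blast
qed

text \<open>At height 1 the coefficients of a conic combination of points of height 1 automatically
  sum to 1.\<close>

lemma hull_iff:
  assumes S: "S \<in> K'" and x: "coord_sum x = 1"
  shows "x \<in> convex hull S \<longleftrightarrow> x \<in> conic_span S"
proof -
  have "sum c S = 1" if "x = (\<Sum>s\<in>S. c s *\<^sub>R s)" for c
    using coord_sum_combination[OF finite_simplex[OF S], of c] x that vertex_coords(2)[OF _ S] by simp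
  then have "(\<exists>c. (\<forall>s\<in>S. 0 \<le> c s) \<and> sum c S = 1 \<and> (\<Sum>s\<in>S. c s *\<^sub>R s) = x) \<longleftrightarrow>
      (\<exists>c. (\<forall>s\<in>S. 0 \<le> c s) \<and> x = (\<Sum>s\<in>S. c s *\<^sub>R s))"
    by metis
  then show ?thesis
    unfolding conic_span_iff[OF finite_simplex[OF S] independent_simplex[OF S]]
      convex_hull_finite[OF finite_simplex[OF S]] mem_Collect_eq .
qed

text \<open>Apart from 0, which lies in every cone, each point of a cone is rescaled to height 1,
  where the intersection and covering conditions of the subdivision apply.\<close>

lemma conic_subdivision_subdiv_of:
  assumes A: "A \<in> K"
  shows "conic_subdivision (vertex_point ` A) (subdiv_of A)"
proof
  have fA: "finite A" using finite_face[OF A] .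
  then show "finite (vertex_point ` A)" "independent (vertex_point ` A)" "finite (subdiv_of A)"
    by (simp_all add: independent_vertex_points finite_subdiv_of)
  show "finite S" "independent S" if "S \<in> subdiv_of A" for S
    using that finite_simplex independent_simplex by (auto simp: subdiv_of_def)
  show "S \<subseteq> conic_span (vertex_point ` A)" if "S \<in> subdiv_of A" for S
    using that vertex_coords(1) by (auto simp: conic_span_vertex_points[OF fA] subdiv_of_def)
  show "conic_span S \<inter> conic_span T \<subseteq> conic_span (S \<inter> T)" if "S \<in> subdiv_of A" "T \<in> subdiv_of A" for S T
  proof
    fix x assume x: "x \<in> conic_span S \<inter> conic_span T"
    have ST: "S \<in> K'" "T \<in> K'" "S \<inter> T \<in> K'" using that simplex_subset by (auto simp: subdiv_of_def)
    show "x \<in> conic_span (S \<inter> T)"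
    proof (cases "x = 0")
      case True
      then show ?thesis by (simp add: conic_span_def span_zero representation_zero)
    next
      case False
      obtain c where c: "\<And>s. s \<in> S \<Longrightarrow> 0 \<le> c s" "x = (\<Sum>s\<in>S. c s *\<^sub>R s)"
        using x conic_span_iff[OF finite_simplex[OF ST(1)] independent_simplex[OF ST(1)]] by blast
      have "0 \<le> Poly_Mapping.lookup x v" for v
        unfolding c(2) lookup_sum using c(1) vertex_coords(1)[OF _ ST(1)]
        by (intro sum_nonneg) simp
      then have pos: "0 < coord_sum x" using False by (rule coord_sum_pos)
      define y where "y = (1 / coord_sum x) *\<^sub>R x"
      have y: "coord_sum y = 1" "x = coord_sum x *\<^sub>R y" using pos by (simp_all add: y_def coord_sum_scale)
      have "y \<in> conic_span S" "y \<in> conic_span T"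
        unfolding y_def using x pos ST independent_simplex by (auto intro!: conic_span_scale)
      then have "y \<in> convex hull (S \<inter> T)"
        using hull_iff[OF ST(1) y(1)] hull_iff[OF ST(2) y(1)] inter_hull[OF ST(1,2)] by blast
      then have "y \<in> conic_span (S \<inter> T)" using hull_iff y(1) ST by blast
      then show ?thesis using y(2) pos ST independent_simplex conic_span_scale by (metis less_imp_le)
    qed
  qed
  show "conic_span (vertex_point ` A) \<subseteq> (\<Union>S\<in>subdiv_of A. conic_span S)"
  proof
    fix x assume "x \<in> conic_span (vertex_point ` A)"
    then have x: "Poly_Mapping.keys x \<subseteq> A" "\<And>v. 0 \<le> Poly_Mapping.lookup x v"
      by (auto simp: conic_span_vertex_points[OF fA])
    show "x \<in> (\<Union>S\<in>subdiv_of A. conic_span S)"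
    proof (cases "x = 0")
      case True
      then show ?thesis using empty_mem
        by (auto intro!: bexI[of _ "{}"] simp: conic_span_def subdiv_of_def representation_zero)
    next
      case False
      have pos: "0 < coord_sum x" using x(2) False by (rule coord_sum_pos)
      define y where "y = (1 / coord_sum x) *\<^sub>R x"
      have y: "coord_sum y = 1" "x = coord_sum x *\<^sub>R y" using pos by (simp_all add: y_def coord_sum_scale)
      have keys_y: "Poly_Mapping.keys y \<subseteq> A" using x(1) by (auto simp: y_def in_keys_iff)
      have "y \<in> geom_simplex A"
        using x(2) pos keys_y y(1) by (auto simp: geom_simplex_iff[OF fA] y_def)
      then have "y \<in> (\<Union>S\<in>K'. convex hull S)"
        using A covered by (auto simp: polyhedron_of_def)
      then obtain S where S: "S \<in> K'" "y \<in> convex hull S" by blast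
      then have "y \<in> conic_span S" using hull_iff y(1) by blast
      then obtain c where c: "\<And>s. s \<in> S \<Longrightarrow> 0 \<le> c s" "y = (\<Sum>s\<in>S. c s *\<^sub>R s)"
        using conic_span_iff[OF finite_simplex[OF S(1)] independent_simplex[OF S(1)]] by blast
      \<comment> \<open>A simplex through \<open>y\<close> may stick out of \<open>A\<close>. Its
        vertices with nonzero coefficient do not: their coordinates outside \<open>A\<close> are
        nonnegative and add up, with positive weights, to 0.\<close>
      define S0 where "S0 = {s \<in> S. c s \<noteq> 0}"
      have S0: "S0 \<in> K'" using S(1) simplex_subset by (auto simp: S0_def)
      have y0: "y = (\<Sum>s\<in>S0. c s *\<^sub>R s)"
        unfolding c(2) S0_def using finite_simplex[OF S(1)] by (intro sum.mono_neutral_right) auto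
      have "Poly_Mapping.keys s \<subseteq> A" if s: "s \<in> S0" for s
      proof
        fix v assume v: "v \<in> Poly_Mapping.keys s"
        show "v \<in> A"
        proof (rule ccontr)
          assume "v \<notin> A"
          then have "Poly_Mapping.lookup y v = 0" using keys_y by (auto simp: in_keys_iff)
          then have "(\<Sum>s\<in>S0. c s * Poly_Mapping.lookup s v) = 0" by (simp add: y0 lookup_sum)
          moreover have "0 \<le> c s * Poly_Mapping.lookup s v" if "s \<in> S0" for s
            using that c(1) vertex_coords(1)[OF _ S0] by (auto simp: S0_def)
          ultimately have "c s * Poly_Mapping.lookup s v = 0"
            using s finite_simplex[OF S0] by (simp add: sum_nonneg_eq_0_iff)
          then show False using s v by (simp add: S0_def in_keys_iff)
        qed
      qed
      then have "S0 \<in> subdiv_of A" using S0 by (simp add: subdiv_of_def)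
      moreover have "y \<in> conic_span S0"
        unfolding conic_span_iff[OF finite_simplex[OF S0] independent_simplex[OF S0]]
        using y0 c(1) by (auto simp: S0_def)
      then have "x \<in> conic_span S0"
        using y(2) pos S0 independent_simplex conic_span_scale by (metis less_imp_le)
      ultimately show ?thesis by blast
    qed
  qed
qed

lemma card_le_of_subdiv_of:
  assumes "finite A" "S \<in> subdiv_of A"
  shows "card S \<le> card A"
proof -
  have "S \<subseteq> span (vertex_point ` A)" "independent S"
    using assms independent_simplex by (auto simp: subdiv_of_def span_vertex_points)
  then have "card S \<le> card (vertex_point ` A)"
    using independent_span_bound[of "vertex_point ` A" S] assms(1) by simp
  then show ?thesis using card_image_le[OF assms(1)] le_trans by blast
qed

text \<open>This is \<open>facet_degree\<close> for the cone over \<open>A\<close>: its facet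
  opposite \<open>a\<close> corresponds to the face \<open>A - {a}\<close>, in which
  \<open>T\<close> is again top-dimensional.\<close>

lemma top_simplices_facet_degree:
  assumes A: "A \<in> K" and T: "T \<in> subdiv_of A" "Suc (card T) = card A"
  shows "card {S \<in> top_simplices A. T \<subset> S} + card {a \<in> A. T \<in> top_simplices (A - {a})} = 2"
proof -
  have fA: "finite A" using finite_face[OF A] .
  interpret conic_subdivision "vertex_point ` A" "subdiv_of A"
    by (rule conic_subdivision_subdiv_of[OF A])
  have cA: "card (vertex_point ` A) = card A"
    by (simp add: card_image inj_on_subset[OF inj_vertex_point])
  have "{d \<in> vertex_point ` A. T \<subseteq> span (vertex_point ` A - {d})} =
      vertex_point ` {a \<in> A. T \<in> top_simplices (A - {a})}"
  proof -
    have "T \<subseteq> span (vertex_point ` A - {vertex_point a}) \<longleftrightarrow> T \<in> top_simplices (A - {a})"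
      if "a \<in> A" for a
    proof -
      have "vertex_point ` A - {vertex_point a} = vertex_point ` (A - {a})"
        by (simp add: image_set_diff[OF inj_vertex_point])
      then show ?thesis
        using that T fA by (auto simp: span_vertex_points top_simplices_def subdiv_of_def)
    qed
    then show ?thesis by auto
  qed
  then have "card {d \<in> vertex_point ` A. T \<subseteq> span (vertex_point ` A - {d})} =
      card {a \<in> A. T \<in> top_simplices (A - {a})}"
    by (simp add: card_image inj_on_subset[OF inj_vertex_point])
  moreover have "{S \<in> top_simplices A. T \<subset> S} = {S \<in> subdiv_of A. card S = card A \<and> T \<subset> S}"
    by (auto simp: top_simplices_def)
  ultimately show ?thesis using facet_degree[OF T(1)] T(2) cA by simp
qed

text \<open>Double counting modulo 2: a codimension-one simplex interior to \<open>A\<close> is a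
  facet of two top simplices and cancels, one in the boundary is a facet of one top simplex and is
  itself a top simplex of one facet of \<open>A\<close>.\<close>

theorem sum_facets_top_simplices:
  fixes \<phi> :: "('a \<Rightarrow>\<^sub>0 real) set \<Rightarrow> bit"
  assumes A: "A \<in> K"
  shows "(\<Sum>S\<in>top_simplices A. \<Sum>x\<in>S. \<phi> (S - {x})) =
    (\<Sum>a\<in>A. \<Sum>T\<in>top_simplices (A - {a}). \<phi> T)"
proof -
  define R where "R = {T \<in> subdiv_of A. Suc (card T) = card A}"
  have fA: "finite A" using finite_face[OF A] .
  have fR: "finite R" using finite_subdiv_of by (simp add: R_def)
  have "(\<Sum>x\<in>S. \<phi> (S - {x})) = (\<Sum>T | T \<in> R \<and> T \<subset> S. \<phi> T)" if S: "S \<in> top_simplices A" for S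
  proof -
    have SK: "S \<in> K'" "finite S" and cS: "card S = card A"
      using S finite_simplex by (auto simp: top_simplices_def subdiv_of_def)
    have "{T. T \<in> R \<and> T \<subset> S} = (\<lambda>x. S - {x}) ` S"
    proof (intro subset_antisym subsetI)
      fix T assume "T \<in> {T. T \<in> R \<and> T \<subset> S}"
      then have T: "T \<subset> S" "Suc (card T) = card S" using cS by (auto simp: R_def)
      then have "card (S - T) = 1" using finite_subset[of T S] SK(2)
        by (simp add: card_Diff_subset psubset_eq flip: T(2))
      then obtain x where "S - T = {x}" by (auto simp: card_1_singleton_iff)
      then have "x \<in> S" "T = S - {x}" using T by auto
      then show "T \<in> (\<lambda>x. S - {x}) ` S" by blast
    next
      fix T assume "T \<in> (\<lambda>x. S - {x}) ` S"
      then obtain x where x: "x \<in> S" "T = S - {x}" by auto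
      have "Suc (card T) = card A" using x SK(2) cS card_Suc_Diff1 by metis
      moreover have "T \<in> subdiv_of A"
        using S x simplex_subset[OF SK(1), of T] by (auto simp: top_simplices_def subdiv_of_def)
      ultimately show "T \<in> {T. T \<in> R \<and> T \<subset> S}" using x by (auto simp: R_def)
    qed
    moreover have "inj_on (\<lambda>x. S - {x}) S" by (auto simp: inj_on_def)
    ultimately show ?thesis by (simp add: sum.reindex)
  qed
  then have "(\<Sum>S\<in>top_simplices A. \<Sum>x\<in>S. \<phi> (S - {x})) =
      (\<Sum>S\<in>top_simplices A. \<Sum>T | T \<in> R \<and> T \<subset> S. \<phi> T)"
    by simp
  also have "\<dots> = (\<Sum>T\<in>R. \<Sum>S | S \<in> top_simplices A \<and> T \<subset> S. \<phi> T)"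
    using finite_top_simplices fR by (rule sum.swap_restrict)
  also have "\<dots> = (\<Sum>T\<in>R. \<Sum>a | a \<in> A \<and> T \<in> top_simplices (A - {a}). \<phi> T)"
  proof (rule sum.cong[OF refl])
    fix T assume T: "T \<in> R"
    have "card {S \<in> top_simplices A. T \<subset> S} + card {a \<in> A. T \<in> top_simplices (A - {a})} = 2"
      using T by (intro top_simplices_facet_degree[OF A]) (auto simp: R_def)
    \<comment> \<open>Two numbers with sum 2 have the same parity, and a constant sum in
      \<open>bit\<close> depends only on the parity of its number of terms.\<close>
    then have "odd (card {S \<in> top_simplices A. T \<subset> S}) = odd (card {a \<in> A. T \<in> top_simplices (A - {a})})"
      by presburger
    then have "(of_nat (card {S \<in> top_simplices A. T \<subset> S}) :: bit) =
        of_nat (card {a \<in> A. T \<in> top_simplices (A - {a})})"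
      by (simp only: of_nat_bit)
    then show "(\<Sum>S | S \<in> top_simplices A \<and> T \<subset> S. \<phi> T) =
        (\<Sum>a | a \<in> A \<and> T \<in> top_simplices (A - {a}). \<phi> T)"
      by (simp only: sum_constant)
  qed
  also have "\<dots> = (\<Sum>a\<in>A. \<Sum>T | T \<in> R \<and> T \<in> top_simplices (A - {a}). \<phi> T)"
    using fR fA by (rule sum.swap_restrict[symmetric, OF _ _, rotated])
  also have "\<dots> = (\<Sum>a\<in>A. \<Sum>T\<in>top_simplices (A - {a}). \<phi> T)"
  proof (intro sum.cong refl)
    fix a assume a: "a \<in> A"
    have "T \<in> R" if T: "T \<in> top_simplices (A - {a})" for T
    proof -
      have "T \<in> subdiv_of A" "card T = card (A - {a})"
        using T unfolding top_simplices_def subdiv_of_def by blast+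
      then show ?thesis using card_Suc_Diff1[OF fA a] by (simp only: R_def mem_Collect_eq)
    qed
    then show "{T. T \<in> R \<and> T \<in> top_simplices (A - {a})} = top_simplices (A - {a})" by blast
  qed
  finally show ?thesis .
qed

end

section \<open>Sperner's lemma and Fan's local parity relation\<close>

context subdivided_complex
begin

lemma top_simplices_empty: "top_simplices {} = {{}}"
proof -
  have "S = {}" if "S \<in> top_simplices {}" for S
    using that finite_simplex by (auto simp: top_simplices_def subdiv_of_def)
  moreover have "{} \<in> top_simplices {}"
    using empty_mem by (simp add: top_simplices_def subdiv_of_def)
  ultimately show ?thesis by blast
qed

lemma top_simplexD:
  assumes "S \<in> top_simplices A"
  shows "S \<in> K'" "finite S" "card S = card A" "\<And>x. x \<in> S \<Longrightarrow> Poly_Mapping.keys x \<subseteq> A"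
  using assms finite_simplex unfolding top_simplices_def subdiv_of_def by blast+

text \<open>\<open>g\<close> is a Sperner labelling, since it picks labels from supports. Induction
  on the dimension: count facets labelled bijectively by \<open>B = A - {a}\<close>. A fully
  labelled simplex has one, any other an even number, and in the boundary of \<open>A\<close> they
  occur only in the face \<open>B\<close>.\<close>

theorem sperner:
  assumes "A \<in> K" and g: "\<And>x S. S \<in> K' \<Longrightarrow> x \<in> S \<Longrightarrow> g x \<in> Poly_Mapping.keys x"
  shows "(\<Sum>S\<in>top_simplices A. of_bool (g ` S = A)) = (1 :: bit)"
  using assms(1)
proof (induction "card A" arbitrary: A)
  case 0
  then have "A = {}" using finite_face by simp
  then show ?case by (simp add: top_simplices_empty)
next
  case (Suc n)
  have fA: "finite A" using Suc.prems by (rule finite_face)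
  obtain a where a: "a \<in> A" using Suc.hyps(2) by fastforce
  define B where "B = A - {a}"
  have B: "B \<in> K" using face_subset[OF Suc.prems] by (simp add: B_def)
  have IH: "(\<Sum>T\<in>top_simplices B. of_bool (g ` T = B)) = (1 :: bit)"
    using Suc.hyps a fA by (intro Suc.hyps(1) B) (simp add: B_def)
  have sub: "g ` S \<subseteq> C" if "S \<in> top_simplices C" for S C
    using top_simplexD[OF that] g by blast
  \<comment> \<open>Injectivity is included so that non-injective labellings fall under the
    cancellation lemma; for top simplices of \<open>B\<close> it is automatic by
    cardinality.\<close>
  define \<phi> where "\<phi> T = (of_bool (inj_on g T \<and> g ` T = B) :: bit)" for T
  have "(\<Sum>x\<in>S. \<phi> (S - {x})) = of_bool (g ` S = A)" if S: "S \<in> top_simplices A" for S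
  proof (cases "inj_on g S")
    case True
    have "card (g ` S) = card A" using True top_simplexD(3)[OF S] by (simp add: card_image)
    then have gS: "g ` S = A" using sub[OF S] fA by (simp add: card_subset_eq)
    then obtain x0 where x0: "x0 \<in> S" "g x0 = a" using a by blast
    have "\<phi> (S - {x}) = (if x = x0 then 1 else 0)" if x: "x \<in> S" for x
    proof -
      have inj: "inj_on g (S - {x})" using True by (rule inj_on_subset) blast
      have "g ` (S - {x}) = A - {g x}" using gS x True by (auto simp: inj_on_def)
      moreover have "g x \<in> A" using gS x by blast
      ultimately have "g ` (S - {x}) = B \<longleftrightarrow> g x = a" using a by (auto simp: B_def)
      also have "\<dots> \<longleftrightarrow> x = x0" using x0 x True by (auto simp: inj_on_def)
      finally show ?thesis using inj by (simp add: \<phi>_def)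
    qed
    then have "(\<Sum>x\<in>S. \<phi> (S - {x})) = (\<Sum>x\<in>S. if x = x0 then 1 else 0)" by simp
    also have "\<dots> = 1" using x0 top_simplexD(2)[OF S] by simp
    finally show ?thesis using gS by simp
  next
    case False
    then have "g ` S \<noteq> A"
      using eq_card_imp_inj_on[of S g] top_simplexD(2,3)[OF S] by auto
    then show ?thesis
      using sum_remove_not_inj[OF top_simplexD(2)[OF S] False, of "\<lambda>X. X = B"] by (simp add: \<phi>_def)
  qed
  then have "(\<Sum>S\<in>top_simplices A. of_bool (g ` S = A)) = (\<Sum>S\<in>top_simplices A. \<Sum>x\<in>S. \<phi> (S - {x}))"
    by simp
  also have "\<dots> = (\<Sum>b\<in>A. \<Sum>T\<in>top_simplices (A - {b}). \<phi> T)"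
    by (rule sum_facets_top_simplices[OF Suc.prems])
  also have "\<dots> = (\<Sum>b\<in>A. if b = a then 1 else 0)"
  proof (rule sum.cong[OF refl])
    fix b assume b: "b \<in> A"
    show "(\<Sum>T\<in>top_simplices (A - {b}). \<phi> T) = (if b = a then 1 else 0)"
    proof (cases "b = a")
      case True
      have "\<phi> T = of_bool (g ` T = B)" if T: "T \<in> top_simplices B" for T
        using eq_card_imp_inj_on[of T g] top_simplexD(2,3)[OF T] by (auto simp: \<phi>_def)
      then show ?thesis using IH True by (simp add: B_def)
    next
      case False
      \<comment> \<open>Labels inside \<open>A - {b}\<close> never equal \<open>b\<close>, whereas
        \<open>B\<close> contains \<open>b\<close>.\<close>
      have "\<phi> T = 0" if T: "T \<in> top_simplices (A - {b})" for T
        using sub[OF T] False b by (auto simp: \<phi>_def B_def)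
      then show ?thesis using False by simp
    qed
  qed
  also have "\<dots> = 1" using a fA by simp
  finally show ?case .
qed

text \<open>Counting positive alternating facets of all top simplices in two ways: simplex by
  simplex through the label sets, and through the boundary of \<open>A\<close>.\<close>

theorem fan_local:
  assumes A: "A \<in> K" "A \<noteq> {}"
    and l: "\<And>S u v. S \<in> K' \<Longrightarrow> u \<in> S \<Longrightarrow> v \<in> S \<Longrightarrow> l u + l v \<noteq> 0"
  shows "(\<Sum>S\<in>top_simplices A. of_bool (alternating_from 1 l S)) +
      (\<Sum>S\<in>top_simplices A. of_bool (alternating_from (-1) l S)) =
    (\<Sum>a\<in>A. \<Sum>T\<in>top_simplices (A - {a}). of_bool (alternating_from 1 l T) :: bit)"
proof -
  have "(\<Sum>x\<in>S. of_bool (alternating_from 1 l (S - {x}))) =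
      (of_bool (alternating_from 1 l S) + of_bool (alternating_from (-1) l S) :: bit)"
    if S: "S \<in> top_simplices A" for S
  proof (rule sum_alternating_from_remove)
    show "S \<noteq> {}" using top_simplexD(3)[OF S] A finite_face by force
  qed (use top_simplexD[OF S] l in auto)
  note facets = this
  have "(\<Sum>S\<in>top_simplices A. of_bool (alternating_from 1 l S)) +
      (\<Sum>S\<in>top_simplices A. of_bool (alternating_from (-1) l S)) =
      (\<Sum>S\<in>top_simplices A. of_bool (alternating_from 1 l S) + of_bool (alternating_from (-1) l S) :: bit)"
    by (rule sum.distrib[symmetric])
  also have "\<dots> = (\<Sum>S\<in>top_simplices A. \<Sum>x\<in>S. of_bool (alternating_from 1 l (S - {x})))"
    by (intro sum.cong refl facets[symmetric])
  also have "\<dots> = (\<Sum>a\<in>A. \<Sum>T\<in>top_simplices (A - {a}). of_bool (alternating_from 1 l T))"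
    by (rule sum_facets_top_simplices[OF A(1)])
  finally show ?thesis .
qed

lemma carrier_subdiv_of:
  assumes "S \<in> K'"
  obtains A where "A \<in> K" "S \<in> subdiv_of A"
proof -
  obtain A where A: "A \<in> K" "\<And>x. x \<in> S \<Longrightarrow> x \<in> geom_simplex A" using carrier[OF assms] by blast
  then have "S \<in> subdiv_of A"
    using assms geom_simplex_iff[OF finite_face[OF A(1)]] unfolding subdiv_of_def by blast
  then show thesis using that A(1) by blast
qed

text \<open>The bound \<open>N\<close> forces a carrier of a simplex with \<open>N\<close> vertices
  to have exactly \<open>N\<close> vertices. It is unique, since a simplex in two such faces would
  lie in their smaller intersection.\<close>

lemma sum_top_simplices:
  fixes f :: "('a \<Rightarrow>\<^sub>0 real) set \<Rightarrow> 'b::comm_monoid_add"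
  assumes dim: "\<And>A. A \<in> K \<Longrightarrow> card A \<le> N"
  shows "(\<Sum>S | S \<in> K' \<and> card S = N. f S) = (\<Sum>A | A \<in> K \<and> card A = N. \<Sum>S\<in>top_simplices A. f S)"
proof -
  have "{S. S \<in> K' \<and> card S = N} = (\<Union>A\<in>{A. A \<in> K \<and> card A = N}. top_simplices A)"
  proof (intro subset_antisym subsetI)
    fix S assume "S \<in> {S. S \<in> K' \<and> card S = N}"
    then have S: "S \<in> K'" "card S = N" by auto
    obtain A where A: "A \<in> K" "S \<in> subdiv_of A" using carrier_subdiv_of[OF S(1)] by blast
    then have "card A = N" using card_le_of_subdiv_of[OF finite_face A(2)] S(2) dim[OF A(1)] by simp
    then show "S \<in> (\<Union>A\<in>{A. A \<in> K \<and> card A = N}. top_simplices A)"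
      using A S(2) by (auto simp: top_simplices_def)
  qed (use top_simplexD in auto)
  moreover have "top_simplices A \<inter> top_simplices B = {}"
    if AB: "A \<in> K" "card A = N" "B \<in> K" "card B = N" "A \<noteq> B" for A B
  proof (rule ccontr)
    assume "top_simplices A \<inter> top_simplices B \<noteq> {}"
    then obtain S where S: "S \<in> top_simplices A" "S \<in> top_simplices B" by blast
    then have "S \<in> subdiv_of (A \<inter> B)" unfolding top_simplices_def subdiv_of_def by blast
    then have "card A \<le> card (A \<inter> B)"
      using card_le_of_subdiv_of[of "A \<inter> B" S] finite_face[OF AB(1)] top_simplexD(3)[OF S(1)] by simp
    then have "A \<inter> B = A" using finite_face[OF AB(1)] by (intro card_seteq) auto
    then have "A = B" using AB finite_face[OF AB(3)] card_seteq[of B A] by auto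
    then show False using AB by simp
  qed
  moreover have "finite {A. A \<in> K \<and> card A = N}"
    using complex by (simp add: abstract_complex_def)
  ultimately show ?thesis
    using finite_top_simplices by (simp add: sum.UNION_disjoint)
qed

end

section \<open>Equivariant subdivisions\<close>

lemma lookup_induced_map:
  "Poly_Mapping.lookup (induced_map f x) u =
    (\<Sum>v\<in>Poly_Mapping.keys x. if f v = u then Poly_Mapping.lookup x v else 0)"
  unfolding induced_map_def lookup_sum by (simp add: lookup_single when_def)

text \<open>Injectivity on the support keeps coefficients from being merged, so none can
  cancel.\<close>

lemma keys_induced_map:
  assumes "inj_on f (Poly_Mapping.keys x)"
  shows "Poly_Mapping.keys (induced_map f x) = f ` Poly_Mapping.keys x"
proof -
  have "Poly_Mapping.lookup (induced_map f x) (f v) = Poly_Mapping.lookup x v"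
    if v: "v \<in> Poly_Mapping.keys x" for v
  proof -
    have "Poly_Mapping.lookup (induced_map f x) (f v) =
        (\<Sum>w\<in>Poly_Mapping.keys x. if w = v then Poly_Mapping.lookup x w else 0)"
      unfolding lookup_induced_map using v assms by (intro sum.cong) (auto dest: inj_onD)
    then show ?thesis using v by simp
  qed
  moreover have "Poly_Mapping.lookup (induced_map f x) u = 0" if "u \<notin> f ` Poly_Mapping.keys x" for u
    unfolding lookup_induced_map using that by (intro sum.neutral) auto
  ultimately show ?thesis by (auto simp: in_keys_iff)
qed

locale z2_subdivided_complex = subdivided_complex +
  fixes \<nu> :: "'a \<Rightarrow> 'a"
  assumes invol: "v \<in> \<Union>K \<Longrightarrow> \<nu> (\<nu> v) = v"
    and z2: "z2_complex K' (induced_map \<nu>)"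
begin

lemma induced_invol: "x \<in> \<Union>K' \<Longrightarrow> induced_map \<nu> (induced_map \<nu> x) = x"
  and induced_simplex: "S \<in> K' \<Longrightarrow> induced_map \<nu> ` S \<in> K'"
  and induced_free: "S \<in> K' \<Longrightarrow> S \<inter> induced_map \<nu> ` S = {}"
proof -
  have "\<forall>v\<in>\<Union>K'. induced_map \<nu> (induced_map \<nu> v) = v"
    using z2 unfolding z2_complex_def by (elim conjE)
  then show "x \<in> \<Union>K' \<Longrightarrow> induced_map \<nu> (induced_map \<nu> x) = x" by (rule bspec)
  have "\<forall>S\<in>K'. induced_map \<nu> ` S \<in> K'"
    using z2 unfolding z2_complex_def by (elim conjE)
  then show "S \<in> K' \<Longrightarrow> induced_map \<nu> ` S \<in> K'" by (rule bspec)
  have "\<forall>S\<in>K'. S \<inter> induced_map \<nu> ` S = {}"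
    using z2 unfolding z2_complex_def by (elim conjE)
  then show "S \<in> K' \<Longrightarrow> S \<inter> induced_map \<nu> ` S = {}" by (rule bspec)
qed

lemma induced_vertex: "x \<in> \<Union>K' \<Longrightarrow> induced_map \<nu> x \<in> \<Union>K'"
  by (elim UnionE, rule UnionI, erule induced_simplex, erule imageI)

lemma induced_neq:
  assumes "x \<in> \<Union>K'"
  shows "induced_map \<nu> x \<noteq> x"
proof
  assume eq: "induced_map \<nu> x = x"
  obtain S where S: "S \<in> K'" "x \<in> S" using assms by blast
  then have "induced_map \<nu> x \<in> induced_map \<nu> ` S" by (intro imageI)
  then show False using induced_free[OF S(1)] S(2) eq by (metis IntI emptyE)
qed

lemma keys_subset_vertices:
  assumes "x \<in> \<Union>K'"
  shows "Poly_Mapping.keys x \<subseteq> \<Union>K"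
proof -
  obtain S where S: "S \<in> K'" "x \<in> S" using assms by blast
  obtain A where A: "A \<in> K" "S \<in> subdiv_of A" using carrier_subdiv_of[OF S(1)] by blast
  then have "Poly_Mapping.keys x \<subseteq> A" using S(2) by (simp add: subdiv_of_def)
  then show ?thesis using A(1) by blast
qed

lemma keys_induced:
  assumes "x \<in> \<Union>K'"
  shows "Poly_Mapping.keys (induced_map \<nu> x) = \<nu> ` Poly_Mapping.keys x"
  by (rule keys_induced_map, rule inj_on_inverseI[where g = \<nu>], rule invol)
    (use keys_subset_vertices[OF assms] in blast)

lemma induced_induced_simplex:
  assumes "S \<in> K'"
  shows "induced_map \<nu> ` induced_map \<nu> ` S = S"
proof -
  have "induced_map \<nu> (induced_map \<nu> x) = x" if "x \<in> S" for x
    using that assms by (intro induced_invol) blast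
  then show ?thesis by (simp add: image_image)
qed

lemma inj_on_induced: "S \<in> K' \<Longrightarrow> inj_on (induced_map \<nu>) S"
  by (rule inj_on_inverseI[where g = "induced_map \<nu>"], rule induced_invol) blast

lemma induced_top_simplex:
  assumes A: "A \<in> K" and S: "S \<in> top_simplices A"
  shows "induced_map \<nu> ` S \<in> top_simplices (\<nu> ` A)"
proof -
  have SK: "S \<in> K'" using top_simplexD(1)[OF S] .
  have "inj_on \<nu> A"
    by (rule inj_on_inverseI[where g = \<nu>], rule invol) (use A in blast)
  then have "card (induced_map \<nu> ` S) = card (\<nu> ` A)"
    using inj_on_induced[OF SK] top_simplexD(3)[OF S] by (simp add: card_image)
  moreover have "Poly_Mapping.keys (induced_map \<nu> x) \<subseteq> \<nu> ` A" if "x \<in> S" for x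
  proof -
    have "x \<in> \<Union>K'" using that SK by (rule UnionI[rotated])
    then show ?thesis using keys_induced image_mono[OF top_simplexD(4)[OF S that]] by simp
  qed
  ultimately show ?thesis
    using induced_simplex[OF SK] by (simp add: top_simplices_def subdiv_of_def)
qed

lemma sum_alternating_antipodal:
  assumes A: "A \<in> K" "\<nu> ` A \<in> K"
    and l: "\<And>x. x \<in> \<Union>K' \<Longrightarrow> l (induced_map \<nu> x) = - l x"
  shows "(\<Sum>S\<in>top_simplices (\<nu> ` A). of_bool (alternating_from s l S)) =
    (\<Sum>S\<in>top_simplices A. of_bool (alternating_from (- s) l S) :: bit)"
proof (rule sum.reindex_bij_witness[where i = "image (induced_map \<nu>)" and j = "image (induced_map \<nu>)"])
  have AA: "\<nu> ` \<nu> ` A = A"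
  proof -
    have "\<nu> (\<nu> v) = v" if "v \<in> A" for v using that A(1) by (intro invol UnionI)
    then show ?thesis by (simp add: image_image)
  qed
  fix S assume S: "S \<in> top_simplices (\<nu> ` A)"
  show "induced_map \<nu> ` induced_map \<nu> ` S = S"
    by (rule induced_induced_simplex[OF top_simplexD(1)[OF S]])
  show "induced_map \<nu> ` S \<in> top_simplices A"
    using induced_top_simplex[OF A(2) S] AA by simp
  have "alternating_from (- s) l (induced_map \<nu> ` S) = alternating_from (- s) (l \<circ> induced_map \<nu>) S"
    by (rule alternating_from_image[OF inj_on_induced[OF top_simplexD(1)[OF S]]])
  also have "\<dots> = alternating_from (- s) (\<lambda>x. - l x) S"
  proof (rule alternating_from_cong)
    fix x assume "x \<in> S"
    then have "x \<in> \<Union>K'" using top_simplexD(1)[OF S] by (rule UnionI[rotated])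
    then show "(l \<circ> induced_map \<nu>) x = - l x" by (simp add: l)
  qed
  finally show "of_bool (alternating_from (- s) l (induced_map \<nu> ` S)) = (of_bool (alternating_from s l S) :: bit)"
    by (simp add: alternating_from_uminus)
next
  fix S assume S: "S \<in> top_simplices A"
  show "induced_map \<nu> ` induced_map \<nu> ` S = S"
    by (rule induced_induced_simplex[OF top_simplexD(1)[OF S]])
  show "induced_map \<nu> ` S \<in> top_simplices (\<nu> ` A)"
    by (rule induced_top_simplex[OF A(1) S])
qed

text \<open>An injective ranking \<open>r\<close> selects one point of each antipodal pair. That
  point receives an arbitrary vertex of its support, its partner the antipode of that
  vertex.\<close>

lemma equivariant_carrier_vertex:
  obtains g where "\<And>x. x \<in> \<Union>K' \<Longrightarrow> g x \<in> Poly_Mapping.keys x"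
    "\<And>x. x \<in> \<Union>K' \<Longrightarrow> g (induced_map \<nu> x) = \<nu> (g x)"
proof -
  let ?\<iota> = "induced_map \<nu>"
  have "finite (\<Union>K')" using finite_K' finite_simplex by (rule finite_Union)
  then obtain r :: "('a \<Rightarrow>\<^sub>0 real) \<Rightarrow> nat" where r: "inj_on r (\<Union>K')"
    by (meson finite_imp_inj_to_nat_seg)
  define c where "c x = (SOME v. v \<in> Poly_Mapping.keys x)" for x :: "'a \<Rightarrow>\<^sub>0 real"
  have c: "c x \<in> Poly_Mapping.keys x" if x: "x \<in> \<Union>K'" for x
  proof -
    obtain S where "S \<in> K'" "x \<in> S" using x by (rule UnionE)
    then have "coord_sum x = 1" by (intro vertex_coords(2))
    then have "Poly_Mapping.keys x \<noteq> {}" by (auto simp: coord_sum_def)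
    then show ?thesis unfolding c_def by (simp add: some_in_eq)
  qed
  define g where "g x = (if r x < r (?\<iota> x) then c x else \<nu> (c (?\<iota> x)))" for x
  have kv: "\<nu> (\<nu> v) = v" if "v \<in> Poly_Mapping.keys x" "x \<in> \<Union>K'" for v x
    using that(1) keys_subset_vertices[OF that(2)] by (intro invol) (rule subsetD)
  have "g x \<in> Poly_Mapping.keys x" if x: "x \<in> \<Union>K'" for x
  proof -
    have "c (?\<iota> x) \<in> \<nu> ` Poly_Mapping.keys x"
      using c[OF induced_vertex[OF x]] keys_induced[OF x] by simp
    then obtain v where "v \<in> Poly_Mapping.keys x" "c (?\<iota> x) = \<nu> v" by blast
    then have "\<nu> (c (?\<iota> x)) \<in> Poly_Mapping.keys x" using kv[OF _ x] by simp
    then show ?thesis using c[OF x] by (simp add: g_def)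
  qed
  moreover have "g (?\<iota> x) = \<nu> (g x)" if x: "x \<in> \<Union>K'" for x
  proof -
    \<comment> \<open>Freeness enters here: a point differs from its antipode, so exactly one of the
      two is selected.\<close>
    have "r x \<noteq> r (?\<iota> x)"
      using inj_onD[OF r _ x induced_vertex[OF x]] induced_neq[OF x] by auto
    moreover have "\<nu> (\<nu> (c (?\<iota> x))) = c (?\<iota> x)"
      using kv[OF c[OF induced_vertex[OF x]] induced_vertex[OF x]] .
    ultimately show ?thesis using induced_invol[OF x] by (simp add: g_def)
  qed
  ultimately show thesis by (rule that)
qed

end

section \<open>Faces of the cross polytope\<close>

text \<open>The facets of the cross polytope boundary, one for each sign vector; the recursion
  splits them by the sign of the last coordinate.\<close>

primrec orthants :: "nat \<Rightarrow> (nat \<Rightarrow>\<^sub>0 real) set set" where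
  "orthants 0 = {{}}"
| "orthants (Suc k) =
     insert (unit_vec (Suc k)) ` orthants k \<union> insert (- unit_vec (Suc k)) ` orthants k"

lemma lookup_unit_vec: "Poly_Mapping.lookup (unit_vec i) j = (if i = j then 1 else 0)"
  by (simp add: unit_vec_def lookup_single when_def)

lemma unit_vec_eq_iff [simp]: "unit_vec i = unit_vec j \<longleftrightarrow> i = j"
  by (metis lookup_unit_vec zero_neq_one)

lemma unit_vec_neq_0 [simp]: "unit_vec i \<noteq> 0"
  by (metis lookup_unit_vec lookup_zero zero_neq_one)

lemma unit_vec_neq_minus [simp]: "unit_vec i \<noteq> - unit_vec j" "- unit_vec i \<noteq> unit_vec j"
proof -
  have "Poly_Mapping.lookup (unit_vec i) i \<noteq> Poly_Mapping.lookup (- unit_vec j) i"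
    by (simp add: lookup_unit_vec)
  then show "unit_vec i \<noteq> - unit_vec j" by metis
  have "Poly_Mapping.lookup (unit_vec j) j \<noteq> Poly_Mapping.lookup (- unit_vec i) j"
    by (simp add: lookup_unit_vec)
  then show "- unit_vec i \<noteq> unit_vec j" by metis
qed

lemma orthants_subset:
  "A \<in> orthants k \<Longrightarrow> A \<subseteq> (\<Union>i\<in>{1..k}. {unit_vec i, - unit_vec i})"
  by (induction k arbitrary: A) (fastforce simp: atLeastAtMostSuc_conv)+

lemma unit_vec_notin_orthants:
  assumes "A \<in> orthants k"
  shows "unit_vec (Suc k) \<notin> A" "- unit_vec (Suc k) \<notin> A"
  using orthants_subset[OF assms] by auto

lemma finite_orthants: "finite (orthants k)"
  by (induction k) auto

lemma orthants_member: "A \<in> orthants k \<Longrightarrow> finite A \<and> card A = k"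
  by (induction k arbitrary: A) (auto simp: unit_vec_notin_orthants)

lemma sum_orthants_Suc:
  "sum f (orthants (Suc k)) =
    (\<Sum>A\<in>orthants k. f (insert (unit_vec (Suc k)) A)) + (\<Sum>A\<in>orthants k. f (insert (- unit_vec (Suc k)) A))"
proof -
  let ?e = "unit_vec (Suc k)"
  have "inj_on (insert s) (orthants k)" if s: "\<And>A. A \<in> orthants k \<Longrightarrow> s \<notin> A" for s
  proof (rule inj_onI)
    fix A B assume "A \<in> orthants k" "B \<in> orthants k" "insert s A = insert s B"
    then show "A = B" using insert_ident[OF s s] by simp
  qed
  then have inj: "inj_on (insert ?e) (orthants k)" "inj_on (insert (- ?e)) (orthants k)"
    using unit_vec_notin_orthants by simp_all
  have "?e \<notin> insert (- ?e) B" if "B \<in> orthants k" for B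
    using unit_vec_notin_orthants(1)[OF that] by simp
  then have "insert ?e ` orthants k \<inter> insert (- ?e) ` orthants k = {}" by blast
  then have "sum f (orthants (Suc k)) = sum f (insert ?e ` orthants k) + sum f (insert (- ?e) ` orthants k)"
    unfolding orthants.simps by (intro sum.union_disjoint) (simp_all add: finite_orthants)
  then show ?thesis using inj by (simp add: sum.reindex)
qed

lemma uminus_orthants: "A \<in> orthants k \<Longrightarrow> uminus ` A \<in> orthants k"
proof (induction k arbitrary: A)
  case (Suc k)
  then obtain B where B: "B \<in> orthants k"
    and "A = insert (unit_vec (Suc k)) B \<or> A = insert (- unit_vec (Suc k)) B" by auto
  then have "uminus ` A = insert (- unit_vec (Suc k)) (uminus ` B) \<or>
      uminus ` A = insert (unit_vec (Suc k)) (uminus ` B)" by auto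
  then show ?case using Suc.IH[OF B] by auto
qed simp

lemma orthants_cross_polytope:
  assumes "A \<in> orthants k" "k \<le> d"
  shows "A \<in> cross_polytope_boundary d"
proof -
  have "\<not> (unit_vec i \<in> A \<and> - unit_vec i \<in> A)" for i
    using assms(1)
  proof (induction k arbitrary: A)
    case (Suc k)
    then obtain B where B: "B \<in> orthants k" and A: "A = insert (unit_vec (Suc k)) B \<or> A = insert (- unit_vec (Suc k)) B"
      by auto
    show ?case
      using Suc.IH[OF B] A unit_vec_notin_orthants[OF B] by (cases "i = Suc k") auto
  qed simp
  moreover have "(\<Union>i\<in>{1..k}. {unit_vec i, - unit_vec i}) \<subseteq> (\<Union>i\<in>{1..d}. {unit_vec i, - unit_vec i})"
    using assms(2) by (intro UN_mono) auto
  then have "A \<subseteq> (\<Union>i\<in>{1..d}. {unit_vec i, - unit_vec i})"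
    by (rule order_trans[OF orthants_subset[OF assms(1)]])
  ultimately show ?thesis by (simp add: cross_polytope_boundary_def)
qed

text \<open>A face contains at most one vertex of the last antipodal pair; deleting it leaves a face
  of the cross polytope of one dimension less.\<close>

lemma cross_polytope_face:
  assumes "A \<in> cross_polytope_boundary d"
  shows "card A \<le> d \<and> (card A = d \<longrightarrow> A \<in> orthants d)"
  using assms
proof (induction d arbitrary: A)
  case 0
  then show ?case by (simp add: cross_polytope_boundary_def)
next
  case (Suc d)
  let ?e = "unit_vec (Suc d)"
  define B where "B = A - {?e, - ?e}"
  have sub: "A \<subseteq> (\<Union>i\<in>{1..Suc d}. {unit_vec i, - unit_vec i})"
    and pair: "\<And>i. i \<in> {1..Suc d} \<Longrightarrow> \<not> {unit_vec i, - unit_vec i} \<subseteq> A"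
    using Suc.prems by (auto simp: cross_polytope_boundary_def)
  have fA: "finite A" using sub by (rule finite_subset) simp
  have "B \<subseteq> (\<Union>i\<in>{1..d}. {unit_vec i, - unit_vec i})"
    using sub by (auto simp: B_def atLeastAtMostSuc_conv)
  moreover have "\<not> {unit_vec i, - unit_vec i} \<subseteq> B" if "i \<in> {1..d}" for i
    using pair[of i] that by (auto simp: B_def)
  ultimately have "B \<in> cross_polytope_boundary d" by (simp add: cross_polytope_boundary_def)
  note B = Suc.IH[OF this]
  have "\<not> (?e \<in> A \<and> - ?e \<in> A)" using pair[of "Suc d"] by auto
  then consider "A = B" | "A = insert ?e B" "?e \<notin> B" | "A = insert (- ?e) B" "- ?e \<notin> B"
    unfolding B_def by blast
  then show ?case
    using B fA by cases auto
qed

lemma cross_polytope_complex: "abstract_complex (cross_polytope_boundary d)"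
proof -
  have "cross_polytope_boundary d \<subseteq> Pow (\<Union>i\<in>{1..d}. {unit_vec i, - unit_vec i})"
    by (auto simp: cross_polytope_boundary_def)
  then have "finite (cross_polytope_boundary d)" by (rule finite_subset) simp
  moreover have "finite A" if "A \<in> cross_polytope_boundary d" for A
    using that by (auto simp: cross_polytope_boundary_def intro: finite_subset)
  moreover have "B \<in> cross_polytope_boundary d" if "A \<in> cross_polytope_boundary d" "B \<subseteq> A" for A B
    using that unfolding cross_polytope_boundary_def by blast
  ultimately show ?thesis by (simp add: abstract_complex_def)
qed

lemma facets_cross_polytope: "{A. A \<in> cross_polytope_boundary d \<and> card A = d} = orthants d"
  using cross_polytope_face orthants_cross_polytope orthants_member by blast

text \<open>Every codimension-one face lies in exactly two orthants, so each term occurs twice. In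
  the induction, removals of the last vertex agree in both halves and cancel; the others vanish by
  the hypothesis for \<open>f\<close> composed with inserting that vertex.\<close>

lemma sum_orthants_remove:
  fixes f :: "(nat \<Rightarrow>\<^sub>0 real) set \<Rightarrow> bit"
  shows "(\<Sum>A\<in>orthants k. \<Sum>a\<in>A. f (A - {a})) = 0"
proof (induction k arbitrary: f)
  case (Suc k)
  have step: "(\<Sum>A\<in>orthants k. \<Sum>a\<in>insert s A. f (insert s A - {a})) = sum f (orthants k)"
    if s: "\<And>A. A \<in> orthants k \<Longrightarrow> s \<notin> A" for s
  proof -
    have "(\<Sum>a\<in>insert s A. f (insert s A - {a})) = f A + (\<Sum>a\<in>A. f (insert s (A - {a})))"
      if A: "A \<in> orthants k" for A
    proof -
      have "insert s A - {a} = insert s (A - {a})" if "a \<in> A" for a using that s[OF A] by auto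
      then show ?thesis using s[OF A] orthants_member[OF A] by simp
    qed
    then show ?thesis using Suc.IH[of "\<lambda>X. f (insert s X)"] by (simp add: sum.distrib)
  qed
  show ?case
    unfolding sum_orthants_Suc using step unit_vec_notin_orthants by simp
qed simp

text \<open>The recursion \<open>h\<close> is what Fan's parity argument yields for the number \<open>P A\<close> of positive
  alternating simplices in a face \<open>A\<close>, since the negative ones correspond to the positive
  ones of the antipodal face.\<close>

lemma sum_orthants_antipodal:
  fixes P :: "(nat \<Rightarrow>\<^sub>0 real) set \<Rightarrow> bit"
  assumes empty: "P {} = 1"
    and h: "\<And>A. A \<in> cross_polytope_boundary d \<Longrightarrow> A \<noteq> {} \<Longrightarrow>
      P A + P (uminus ` A) = (\<Sum>a\<in>A. P (A - {a}))"
  shows "k \<le> d \<Longrightarrow> sum P (orthants k) = 1"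
proof (induction k)
  case (Suc k)
  let ?e = "unit_vec (Suc k)"
  \<comment> \<open>The orthants with negative last coordinate are the antipodes of those with
    positive one.\<close>
  have reindex: "(\<Sum>A\<in>orthants k. P (insert (- ?e) A)) = (\<Sum>A\<in>orthants k. P (uminus ` insert ?e A))"
    by (rule sum.reindex_bij_witness[where i = "image uminus" and j = "image uminus"])
      (auto simp: uminus_orthants image_image)
  \<comment> \<open>\<open>h\<close> for an antipodal pair of orthants, with the removal of
    \<open>?e\<close> split off from the other removals.\<close>
  have "P (insert ?e A) + P (uminus ` insert ?e A) = P A + (\<Sum>a\<in>A. P (insert ?e (A - {a})))"
    if A: "A \<in> orthants k" for A
  proof -
    have "insert ?e A \<in> cross_polytope_boundary d"
      using A Suc.prems by (intro orthants_cross_polytope[of _ "Suc k"]) auto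
    then have "P (insert ?e A) + P (uminus ` insert ?e A) = (\<Sum>a\<in>insert ?e A. P (insert ?e A - {a}))"
      by (intro h) auto
    moreover have "insert ?e A - {a} = insert ?e (A - {a})" if "a \<in> A" for a
      using that unit_vec_notin_orthants[OF A] by auto
    ultimately show ?thesis using unit_vec_notin_orthants[OF A] orthants_member[OF A] by simp
  qed
  then have "(\<Sum>A\<in>orthants k. P (insert ?e A) + P (uminus ` insert ?e A)) =
      (\<Sum>A\<in>orthants k. P A + (\<Sum>a\<in>A. P (insert ?e (A - {a}))))"
    by (rule sum.cong[OF HOL.refl])
  \<comment> \<open>The terms that keep \<open>?e\<close> cancel by
    \<open>sum_orthants_remove\<close>; what remains is the sum over orthants of one dimension
    less.\<close>
  then show ?case
    unfolding sum_orthants_Suc reindex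
    using Suc sum_orthants_remove[where f = "\<lambda>X. P (insert ?e X)" and k = k] by (simp add: sum.distrib)
qed (simp add: empty)

section \<open>Fan's theorem\<close>

lemma uminus_cross_polytope:
  assumes "A \<in> cross_polytope_boundary d"
  shows "uminus ` A \<in> cross_polytope_boundary d"
proof -
  have A: "A \<subseteq> (\<Union>i\<in>{1..d}. {unit_vec i, - unit_vec i})"
    "\<And>i. i \<in> {1..d} \<Longrightarrow> \<not> (unit_vec i \<in> A \<and> - unit_vec i \<in> A)"
    using assms by (auto simp: cross_polytope_boundary_def)
  have "\<exists>i\<in>{1..d}. - x = unit_vec i \<or> - x = - unit_vec i" if "x \<in> A" for x
    using A(1) that by fastforce
  then have "uminus ` A \<subseteq> (\<Union>i\<in>{1..d}. {unit_vec i, - unit_vec i})" by blast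
  moreover have "x \<in> uminus ` A \<longleftrightarrow> - x \<in> A" for x
    by (metis image_eqI imageE minus_minus)
  ultimately show ?thesis using A(2) by (auto simp: cross_polytope_boundary_def)
qed

text \<open>Fan's local relation, with the negative simplices of \<open>A\<close> replaced by the
  positive ones of the antipodal face, is the recursion solved by
  \<open>sum_orthants_antipodal\<close>.\<close>

theorem fan_cross_polytope:
  assumes "subdivision K' (cross_polytope_boundary d)" "K' \<noteq> {}"
    and "z2_complex K' (induced_map uminus)"
    and antipodal: "\<And>x. x \<in> \<Union>K' \<Longrightarrow> l (induced_map uminus x) = - l x"
    and edge: "\<And>S u v. S \<in> K' \<Longrightarrow> u \<in> S \<Longrightarrow> v \<in> S \<Longrightarrow> l u + l v \<noteq> 0"
  shows "(\<Sum>S | S \<in> K' \<and> card S = d. of_bool (alternating_from 1 l S)) = (1 :: bit)"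
proof -
  interpret z2_subdivided_complex K' "cross_polytope_boundary d" uminus
    using assms cross_polytope_complex by unfold_locales auto
  define P where "P A = (\<Sum>S\<in>top_simplices A. of_bool (alternating_from 1 l S) :: bit)" for A
  \<comment> \<open>The empty face contains only the empty simplex, which counts as
    alternating.\<close>
  have "P {} = 1"
    by (simp add: P_def top_simplices_empty alternating_from_def signed_alternating_def)
  moreover have "P A + P (uminus ` A) = (\<Sum>a\<in>A. P (A - {a}))"
    if A: "A \<in> cross_polytope_boundary d" "A \<noteq> {}" for A
  proof -
    have "P (uminus ` A) = (\<Sum>S\<in>top_simplices A. of_bool (alternating_from (-1) l S))"
      unfolding P_def using A(1) uminus_cross_polytope antipodal by (intro sum_alternating_antipodal)
    then show ?thesis unfolding P_def using fan_local[OF A edge] by simp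
  qed
  ultimately have "sum P (orthants d) = 1"
    by (rule sum_orthants_antipodal[OF _ _ order_refl])
  moreover have "(\<Sum>S | S \<in> K' \<and> card S = d. of_bool (alternating_from 1 l S)) =
      (\<Sum>A | A \<in> cross_polytope_boundary d \<and> card A = d. P A)"
    unfolding P_def using cross_polytope_face by (intro sum_top_simplices) blast
  ultimately show ?thesis by (simp add: facets_cross_polytope)
qed

section \<open>Transfer of alternating simplices from the subdivision back to
  \<open>M\<close>\<close>

context subdivided_complex
begin

text \<open>Alternating labels are distinct, so \<open>g\<close> is injective on such a simplex and
  maps it onto \<open>A\<close>. Sperner's lemma makes the number of simplices mapped onto
  \<open>A\<close> odd.\<close>

lemma sum_alternating_carrier:
  assumes A: "A \<in> K" and g: "\<And>x S. S \<in> K' \<Longrightarrow> x \<in> S \<Longrightarrow> g x \<in> Poly_Mapping.keys x"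
  shows "(\<Sum>S\<in>top_simplices A. of_bool (alternating_from s (l \<circ> g) S)) =
    (of_bool (alternating_from s l A) :: bit)"
proof -
  have "of_bool (alternating_from s (l \<circ> g) S) =
      (of_bool (g ` S = A) * of_bool (alternating_from s l A) :: bit)" if S: "S \<in> top_simplices A" for S
  proof (cases "inj_on g S")
    case True
    have "g ` S \<subseteq> A" using top_simplexD(1,4)[OF S] g by blast
    moreover have "card (g ` S) = card A" using True top_simplexD(3)[OF S] by (simp add: card_image)
    ultimately have "g ` S = A" using finite_face[OF A] by (simp add: card_subset_eq)
    then show ?thesis using alternating_from_image[OF True, of s l] by simp
  next
    case False
    then have "g ` S \<noteq> A"
      using eq_card_imp_inj_on[of S g] top_simplexD(2,3)[OF S] by auto
    moreover have "\<not> inj_on (l \<circ> g) S" using False inj_on_imageI2 by blast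
    ultimately show ?thesis by (simp add: alternating_from_def)
  qed
  then have "(\<Sum>S\<in>top_simplices A. of_bool (alternating_from s (l \<circ> g) S)) =
      (\<Sum>S\<in>top_simplices A. of_bool (g ` S = A)) * (of_bool (alternating_from s l A) :: bit)"
    by (simp add: sum_distrib_right)
  then show ?thesis using sperner[OF A, of g] g by simp
qed

end

text \<open>The polyhedron contains the vertex \<open>unit_vec 1\<close>, which some simplex has to
  cover.\<close>

lemma cross_polytope_subdivision_nonempty:
  assumes "subdivision K' (cross_polytope_boundary (Suc n))"
  shows "K' \<noteq> {}"
proof
  assume "K' = {}"
  moreover have "(\<Union>S\<in>K'. convex hull S) = polyhedron_of (cross_polytope_boundary (Suc n))"
    using assms unfolding subdivision_def by (elim conjE)
  moreover have "{unit_vec 1} \<in> cross_polytope_boundary (Suc n)"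
    using orthants_cross_polytope[of "{unit_vec 1}" "Suc 0" "Suc n"] by simp
  moreover have "vertex_point (unit_vec 1) \<in> geom_simplex {unit_vec 1}"
    by (simp add: geom_simplex_def)
  ultimately show False unfolding polyhedron_of_def by blast
qed

theorem theorem11:
  fixes M :: "'a set set" and \<nu> :: "'a \<Rightarrow> 'a" and lab :: "'a \<Rightarrow> int" and n m :: nat
  assumes "centrally_symmetric_sphere n M \<nu>"
    and "combinatorially_z2_equivalent M \<nu> (cross_polytope_boundary (n + 1)) uminus"
    and "\<forall>v\<in>vertices M. lab v \<in> {- int m..int m} - {0}"
    and "\<forall>v\<in>vertices M. lab (\<nu> v) = - lab v"
    and "\<forall>u v. u \<noteq> v \<and> {u, v} \<in> M \<longrightarrow> lab u + lab v \<noteq> 0"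
  shows "odd (card {A \<in> n_simplices n M. positive_alternating lab A}) \<and> m \<ge> n + 1"
proof -
  obtain M' L' where M': "subdivision M' M" "z2_complex M' (induced_map \<nu>)"
    and L': "subdivision L' (cross_polytope_boundary (n + 1))" "z2_complex L' (induced_map uminus)"
    and iso: "z2_isomorphic M' (induced_map \<nu>) L' (induced_map uminus)"
    using assms(2) unfolding combinatorially_z2_equivalent_def z2_subdivision_def by blast
  obtain f where bij: "bij_betw f (\<Union>M') (\<Union>L')" and fM': "image f ` M' = L'"
    and f_equi: "\<And>S. S \<in> M' \<Longrightarrow> f ` induced_map \<nu> ` S = induced_map uminus ` f ` S"
    using iso unfolding z2_isomorphic_def simplicial_iso_def by blast
  have L'_ne: "L' \<noteq> {}" using cross_polytope_subdivision_nonempty L'(1) by simp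
  then have M'_ne: "M' \<noteq> {}" using fM' by blast
  have M: "z2_complex M \<nu>" using assms(1) by (simp add: centrally_symmetric_sphere_def)
  have M_complex: "abstract_complex M" and M_invol: "\<And>v. v \<in> \<Union>M \<Longrightarrow> \<nu> (\<nu> v) = v"
    using M unfolding z2_complex_def by blast+
  interpret M: z2_subdivided_complex M' M \<nu>
    using M'(1,2) M'_ne M_complex M_invol by unfold_locales
  interpret L: subdivided_complex L' "cross_polytope_boundary (n + 1)"
    using L'(1) L'_ne cross_polytope_complex by unfold_locales
  have inj_f: "inj_on f S" if "S \<in> M'" for S
    using bij that by (auto simp: bij_betw_def intro: inj_on_subset)
  have card_f: "card (f ` S) = card S" if "S \<in> M'" for S
    using inj_f[OF that] by (rule card_image)

  obtain g where g: "\<And>x. x \<in> \<Union>M' \<Longrightarrow> g x \<in> Poly_Mapping.keys x"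
    and g_equi: "\<And>x. x \<in> \<Union>M' \<Longrightarrow> g (induced_map \<nu> x) = \<nu> (g x)"
    using M.equivariant_carrier_vertex by metis
  have gS: "g x \<in> Poly_Mapping.keys x" if "S \<in> M'" "x \<in> S" for x S
    using that by (intro g) (rule UnionI)
  have g_vertex: "g x \<in> \<Union>M" if "x \<in> \<Union>M'" for x
    using g[OF that] M.keys_subset_vertices[OF that] by (rule subsetD[rotated])

  \<comment> \<open>Sperner's lemma yields a simplex of \<open>M'\<close> with as many vertices as
    \<open>A\<close>; its image in \<open>L'\<close> lies in a face of the cross polytope, which
    bounds this number.\<close>
  have dim: "card A \<le> n + 1" if A: "A \<in> M" for A
  proof -
    have "(\<Sum>S\<in>M.top_simplices A. of_bool (g ` S = A)) = (1 :: bit)"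
      using A gS by (rule M.sperner)
    then have "M.top_simplices A \<noteq> {}" by (metis sum.empty zero_neq_one)
    then obtain S where S: "S \<in> M.top_simplices A" by blast
    note S = M.top_simplexD[OF S]
    have "f ` S \<in> L'" using fM' S(1) by blast
    then obtain B where B: "B \<in> cross_polytope_boundary (n + 1)" "f ` S \<in> L.subdiv_of B"
      using L.carrier_subdiv_of by blast
    have "card (f ` S) \<le> card B" using L.card_le_of_subdiv_of[OF L.finite_face[OF B(1)] B(2)] .
    also have "\<dots> \<le> n + 1" using cross_polytope_face[OF B(1)] by simp
    finally show ?thesis using S(3) card_f[OF S(1)] by simp
  qed

  have lab_ne: "lab v \<noteq> 0" if "v \<in> \<Union>M" for v
    using assms(3) that by blast
  \<comment> \<open>The counting lemmas need one condition for all pairs in a face, including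
    \<open>u = v\<close>, where it says that labels are nonzero.\<close>
  have lab_face: "lab u + lab v \<noteq> 0" if "A \<in> M" "u \<in> A" "v \<in> A" for A u v
  proof (cases "u = v")
    case True
    then show ?thesis using lab_ne[of u] that by auto
  next
    case False
    have "{u, v} \<in> M" using M.face_subset[OF that(1), of "{u, v}"] that by simp
    then show ?thesis using assms(5) False by blast
  qed
  define h where "h = the_inv_into (\<Union>M') f"
  have h: "h (f x) = x" if "x \<in> \<Union>M'" for x
    unfolding h_def using bij that by (simp add: bij_betw_def the_inv_into_f_f)
  define l where "l = lab \<circ> g \<circ> h"
  have lf: "l (f x) = lab (g x)" if "x \<in> \<Union>M'" for x
    using h[OF that] by (simp add: l_def)

  have "(\<Sum>S | S \<in> L' \<and> card S = n + 1. of_bool (alternating_from 1 l S)) = (1 :: bit)"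
  proof (rule fan_cross_polytope[OF L'(1) L'_ne L'(2)])
    fix y assume "y \<in> \<Union>L'"
    then have "y \<in> f ` \<Union>M'" unfolding bij_betw_imp_surj_on[OF bij] .
    then obtain x where x: "x \<in> \<Union>M'" "y = f x" by (elim imageE)
    \<comment> \<open>The equivariance of \<open>f\<close> is given for simplices as sets; the
      simplex \<open>{x}\<close> turns it into equivariance at the point \<open>x\<close>.\<close>
    obtain S where "S \<in> M'" "x \<in> S" using x(1) by blast
    then have "{x} \<in> M'" using M.simplex_subset[of S "{x}"] by simp
    then have "f (induced_map \<nu> x) = induced_map uminus y"
      using f_equi[of "{x}"] x(2) by simp
    then have "l (induced_map uminus y) = lab (\<nu> (g x))"
      using lf[OF M.induced_vertex[OF x(1)]] g_equi[OF x(1)] by simp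
    also have "\<dots> = - lab (g x)" using assms(4) g_vertex[OF x(1)] by blast
    finally show "l (induced_map uminus y) = - l y" using lf[OF x(1)] x(2) by simp
  next
    fix S u v assume S: "S \<in> L'" and uv: "u \<in> S" "v \<in> S"
    obtain T where T: "T \<in> M'" "S = f ` T" using S fM' by blast
    obtain x y where xy: "x \<in> T" "u = f x" "y \<in> T" "v = f y" using uv T(2) by blast
    \<comment> \<open>Carrier vertices of one simplex of \<open>M'\<close> lie in a common face of
      \<open>M\<close>, so subdividing creates no opposite labels on an edge.\<close>
    obtain A where A: "A \<in> M" "T \<in> M.subdiv_of A" using M.carrier_subdiv_of[OF T(1)] by blast
    have "g x \<in> A" "g y \<in> A"
      using A(2) xy gS[OF T(1)] unfolding M.subdiv_of_def by blast+
    then have "lab (g x) + lab (g y) \<noteq> 0" using lab_face[OF A(1)] by blast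
    moreover have "x \<in> \<Union>M'" "y \<in> \<Union>M'" using xy T(1) by blast+
    ultimately show "l u + l v \<noteq> 0" using lf xy by simp
  qed
  also have "(\<Sum>S | S \<in> L' \<and> card S = n + 1. of_bool (alternating_from 1 l S) :: bit) =
      (\<Sum>S | S \<in> M' \<and> card S = n + 1. of_bool (alternating_from 1 (lab \<circ> g) S))"
  proof -
    have "{S. S \<in> L' \<and> card S = n + 1} = image f ` {S. S \<in> M' \<and> card S = n + 1}"
      using fM' card_f by force
    moreover have "inj_on (image f) {S. S \<in> M' \<and> card S = n + 1}"
    proof (rule inj_onI)
      fix S T assume "S \<in> {S. S \<in> M' \<and> card S = n + 1}" "T \<in> {S. S \<in> M' \<and> card S = n + 1}"
        and eq: "f ` S = f ` T"
      then have "S \<subseteq> \<Union>M'" "T \<subseteq> \<Union>M'" by blast+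
      then show "S = T"
        using eq inj_on_image_eq_iff[OF bij_betw_imp_inj_on[OF bij]] by blast
    qed
    moreover have "alternating_from 1 l (f ` S) = alternating_from 1 (lab \<circ> g) S"
      if "S \<in> M'" for S
    proof -
      have "alternating_from 1 l (f ` S) = alternating_from 1 (l \<circ> f) S"
        by (rule alternating_from_image[OF inj_f[OF that]])
      also have "\<dots> = alternating_from 1 (lab \<circ> g) S"
        using lf that by (intro alternating_from_cong) auto
      finally show ?thesis .
    qed
    ultimately show ?thesis by (simp add: sum.reindex)
  qed
  also have "\<dots> = (\<Sum>A | A \<in> M \<and> card A = n + 1.
      \<Sum>S\<in>M.top_simplices A. of_bool (alternating_from 1 (lab \<circ> g) S))"
    using dim by (rule M.sum_top_simplices)
  \<comment> \<open>Each face of \<open>M\<close> carries, modulo 2, one alternating simplex of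
    \<open>M'\<close> if it is alternating itself and none otherwise.\<close>
  also have "\<dots> = (\<Sum>A | A \<in> M \<and> card A = n + 1. of_bool (alternating_from 1 lab A))"
    by (rule sum.cong[OF refl], rule M.sum_alternating_carrier) (use gS in auto)
  also have "\<dots> = (\<Sum>A | A \<in> M \<and> card A = n + 1. of_bool (positive_alternating lab A))"
  proof (rule sum.cong[OF refl])
    fix A assume "A \<in> {A. A \<in> M \<and> card A = n + 1}"
    then have A: "A \<in> M" "card A = n + 1" by auto
    have "positive_alternating lab A \<longleftrightarrow> alternating_from 1 lab A"
      using M.finite_face[OF A(1)] A lab_ne by (intro positive_alternating_iff) auto
    then show "(of_bool (alternating_from 1 lab A) :: bit) = of_bool (positive_alternating lab A)" by simp
  qed
  also have "\<dots> = of_nat (card {A \<in> n_simplices n M. positive_alternating lab A})"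
  proof -
    have fin: "finite {A. A \<in> M \<and> card A = n + 1}"
      using M_complex by (simp add: abstract_complex_def)
    have eq: "{A \<in> n_simplices n M. positive_alternating lab A} =
        {A. A \<in> M \<and> card A = n + 1} \<inter> {A. positive_alternating lab A}"
      by (auto simp: n_simplices_def)
    show ?thesis unfolding eq by (intro sum_of_bool_eq fin)
  qed
  finally have odd: "odd (card {A \<in> n_simplices n M. positive_alternating lab A})"
    by (simp add: of_nat_bit)
  then have "{A \<in> n_simplices n M. positive_alternating lab A} \<noteq> {}" by (metis card.empty even_zero)
  then obtain A where A: "A \<in> M" "card A = n + 1" "positive_alternating lab A"
    by (auto simp: n_simplices_def)
  have "inj_on lab A" using A(3) by (simp add: positive_alternating_def alternating_def)
  \<comment> \<open>Distinct labels without opposite pairs have distinct absolute values, so the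
    \<open>n + 1\<close> vertices inject into \<open>{1..int m}\<close>.\<close>
  then have "inj_on (\<lambda>v. \<bar>lab v\<bar>) A"
    using lab_face[OF A(1)] by (intro inj_onI) (metis abs_eq_iff add.left_inverse inj_onD)
  moreover have "(\<lambda>v. \<bar>lab v\<bar>) ` A \<subseteq> {1..int m}"
    using assms(3) A(1) lab_ne by fastforce
  ultimately have "card A \<le> card {1..int m}" by (intro card_inj_on_le) auto
  then show ?thesis using odd A(2) by simp
qed

end
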